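(* For every integer $k\ge 1$ there exists $a_0\in(0,1)$ such that for every $a\in(0,a_0]$ there are $k$ distinct non-constant maps $u_1,\dots,u_k\in \dot H^{\frac12}(\mathbb R,\mathbb S^1)$ which are half-harmonic in $I_-\cup I_+:=(-1,-a)\cup(a,1)$ and equal to $1\in\mathbb S^1\subset\mathbb C$ in $\mathbb R\setminus(I_-\cup I_+)$.
   Context: $\mathbb S^1=\{z\in\mathbb C:|z|=1\}$, with $\mathbb C\simeq\mathbb R^2$. $\dot H^{\frac12}(\mathbb R,\mathbb C)$ is the space of measurable $u:\mathbb R\to\mathbb C$ (up to a.e. equality) with $\int_{\mathbb R}\int_{\mathbb R}\frac{|u(x)-u(y)|^2}{|x-y|^2}\,dx\,dy<\infty$, and $\dot H^{\frac12}(\mathbb R,\mathbb S^1)$ is its subset of maps with $|u(x)|=1$ for a.e. $x$. Let $E(u)=\frac1{2\pi}\int_{\mathbb R}\int_{\mathbb R}\frac{|u(x)-u(y)|^2}{|x-y|^2}\,dx\,dy=\int_{\mathbb R^2_+}|\nabla\tilde u|^2\,dx\,dy$, where $\tilde u$ is the Poisson harmonic extension of $u$ to the upper half-plane $\mathbb R^2_+$. For an open set $A\subset\mathbb R$, a map $u\in\dot H^{\frac12}(\mathbb R,\mathbb S^1)$ is half-harmonic in $A$ if $(-\Delta)^{\frac12}u(x):=-\frac{\partial\tilde u}{\partial y}(x,0)\perp T_{u(x)}\mathbb S^1$ for $x\in A$. Equivalently, $u$ is a critical point of $E$ among maps in $\dot H^{\frac12}(\mathbb R,\mathbb S^1)$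 with the same values in $\mathbb R\setminus A$. In weak form: for all $\varphi\in C_c^\infty(A,\mathbb R)$, $\int_{\mathbb R}\int_{\mathbb R}\frac{(u(x)-u(y))\cdot(i u(x)\varphi(x)-i u(y)\varphi(y))}{|x-y|^2}\,dx\,dy=0$, where $\cdot$ is the scalar product of $\mathbb R^2\simeq\mathbb C$. Half-harmonic maps in $A$ are known to be smooth in $A$. *)

theory Defs
  imports "HOL-Analysis.Analysis"
begin

text \<open>Elements of the function spaces are represented by Lebesgue measurable functions; equalities
  between them are to be read almost everywhere. On the diagonal the integrands below take the value
  \<open>0/0 = 0\<close>, which is harmless since the diagonal is a null set.\<close>

definition dot_H_half :: "(real \<Rightarrow> complex) set" where
  "dot_H_half = {u \<in> borel_measurable lebesgue.
     (\<integral>\<^sup>+ x. \<integral>\<^sup>+ y. ennreal ((cmod (u x - u y))\<^sup>2 / \<bar>x - y\<bar>\<^sup>2) \<partial>lebesgue \<partial>lebesgue) < \<infinity>}"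

definition dot_H_half_S1 :: "(real \<Rightarrow> complex) set" where
  "dot_H_half_S1 = {u \<in> dot_H_half. AE x in lebesgue. cmod (u x) = 1}"

definition Cc_infty :: "real set \<Rightarrow> (real \<Rightarrow> real) set" where
  "Cc_infty A = {\<phi>. (\<forall>n x. (deriv ^^ n) \<phi> field_differentiable (at x)) \<and>
     compact (closure {x. \<phi> x \<noteq> 0}) \<and> closure {x. \<phi> x \<noteq> 0} \<subseteq> A}"

text \<open>Weak form of \<open>(-\<Delta>)\<^sup>1\<^sup>/\<^sup>2 u(x) \<bottom> T\<^bsub>u(x)\<^esub> S\<^sup>1\<close>, tested against the tangent fields \<open>i u \<phi>\<close>;
  \<open>\<bullet>\<close> is the real scalar product on the complex plane. For \<open>u\<close> in \<open>dot_H_half_S1\<close> and \<open>\<phi>\<close> in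
  \<open>Cc_infty A\<close> the integrand is absolutely integrable on the plane (Cauchy-Schwarz), so the
  iterated Bochner integral is the double integral.\<close>

definition half_harmonic_in :: "real set \<Rightarrow> (real \<Rightarrow> complex) \<Rightarrow> bool" where
  "half_harmonic_in A u \<longleftrightarrow> u \<in> dot_H_half_S1 \<and>
     (\<forall>\<phi> \<in> Cc_infty A.
        (LINT x|lebesgue. (LINT y|lebesgue.
           ((u x - u y) \<bullet> (\<i> * u x * of_real (\<phi> x) - \<i> * u y * of_real (\<phi> y)))
             / \<bar>x - y\<bar>\<^sup>2)) = 0)"

end

theory Submission
  imports Defs
begin

text \<open>
  We look for \<open>u = exp (i f)\<close> where the real phase \<open>f\<close> is \<open>0\<close> outside \<open>(-1, 1)\<close> and \<open>2 \<pi> n\<close> on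
  \<open>[-a, a]\<close>, for \<open>n = 1, \<dots>, k\<close>. Since a point has zero \<open>H\<^sup>1\<^sup>/\<^sup>2\<close>-capacity, for small \<open>a\<close> there are such
  phases of arbitrarily small \<open>H\<^sup>1\<^sup>/\<^sup>2\<close> norm. The critical embedding of \<open>H\<^sup>1\<^sup>/\<^sup>2\<close> into \<open>W\<^sup>1\<^sup>/\<^sup>4\<^sup>,\<^sup>4\<close>
  makes \<open>f \<mapsto> E (exp (i f))\<close> uniformly convex and comparable to the squared norm on a small ball, so
  it has a minimiser there, which lies in the interior and is therefore half-harmonic. Two phases
  giving the same map differ by a function with values in \<open>2 \<pi> \<int>\<close> of small norm, and such a
  function is constant; hence different \<open>n\<close> give different maps.
\<close>

subsection \<open>The critical Sobolev embedding\<close>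

text \<open>The obstacle: a phase going from \<open>0\<close> to \<open>2 \<pi> n\<close> oscillates
  by at least \<open>2 \<pi>\<close>, and functions of finite \<open>H^(1/2)\<close> norm need not
  be bounded, so increments are never uniformly small and \<open>1 - cos t\<close> cannot be
  compared with \<open>t^2 / 2\<close> pointwise. Smallness is available only in norm. The error in
  that comparison is at most \<open>t^4 / 24\<close>, and integrating it against
  \<open>1 / (x - y)^2\<close> gives exactly the \<open>W^(1/4,4)\<close> seminorm, which the
  embedding controls by the squared quadratic one. Scale invariance is both what makes this
  embedding critical and what makes cutoffs at a point arbitrarily cheap. The minimiser is interior
  because a competitor with \<open>sq_norm\<close> below \<open>r / 2\<close> has energy below
  \<open>r / 4\<close>, while energy is at least \<open>sq_norm / 4\<close> in the ball. The radius
  \<open>r\<close> is absolute; \<open>k\<close> enters only through the amplitude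
  \<open>2 \<pi> k\<close> by which the cutoff is multiplied.\<close>

definition gagliardo :: "nat \<Rightarrow> (real \<Rightarrow> real) \<Rightarrow> ennreal" where
  "gagliardo p f = (\<integral>\<^sup>+x. \<integral>\<^sup>+y. ennreal (\<bar>f x - f y\<bar> ^ p / (x - y)\<^sup>2) \<partial>lborel \<partial>lborel)"

lemma gagliardo_shift:
  assumes [measurable]: "f \<in> borel_measurable borel"
  shows "gagliardo p f = (\<integral>\<^sup>+z. ennreal (\<bar>f (fst z + snd z) - f (fst z)\<bar> ^ p / (snd z)\<^sup>2) \<partial>lborel)"
proof -
  have "gagliardo p f = (\<integral>\<^sup>+x. \<integral>\<^sup>+h. ennreal (\<bar>f (x + h) - f x\<bar> ^ p / h\<^sup>2) \<partial>lborel \<partial>lborel)"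
    unfolding gagliardo_def
  proof (rule nn_integral_cong)
    fix x :: real
    show "(\<integral>\<^sup>+y. ennreal (\<bar>f x - f y\<bar> ^ p / (x - y)\<^sup>2) \<partial>lborel) = (\<integral>\<^sup>+h. ennreal (\<bar>f (x + h) - f x\<bar> ^ p / h\<^sup>2) \<partial>lborel)"
      by (subst nn_integral_real_affine[where c=1 and t=x]) (auto simp: abs_minus_commute)
  qed
  also have "\<dots> = (\<integral>\<^sup>+z. ennreal (\<bar>f (fst z + snd z) - f (fst z)\<bar> ^ p / (snd z)\<^sup>2) \<partial>(lborel \<Otimes>\<^sub>M lborel))"
    by (subst lborel.nn_integral_fst[symmetric]) (simp_all add: borel_prod)
  finally show ?thesis by (simp add: lborel_prod)
qed

text \<open>Substituting \<open>h / c\<close> for \<open>h\<close> turns \<open>dh / h^2\<close>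
  into \<open>c dh / h^2\<close>. Increments over the fraction \<open>c\<close> of \<open>h\<close>
  therefore carry only the share \<open>c\<close> of the seminorm, the small factor that later
  permits absorption.\<close>

lemma gagliardo_shift_scaled:
  assumes [measurable]: "f \<in> borel_measurable borel" and c: "c > 0"
  shows "(\<integral>\<^sup>+z. ennreal (\<bar>f (fst z + c * snd z) - f (fst z)\<bar> ^ p / (snd z)\<^sup>2) \<partial>lborel) = ennreal c * gagliardo p f"
proof -
  have "(\<integral>\<^sup>+z. ennreal (\<bar>f (fst z + c * snd z) - f (fst z)\<bar> ^ p / (snd z)\<^sup>2) \<partial>(lborel \<Otimes>\<^sub>M lborel))
    = (\<integral>\<^sup>+x. \<integral>\<^sup>+h. ennreal (\<bar>f (x + c * h) - f x\<bar> ^ p / h\<^sup>2) \<partial>lborel \<partial>lborel)"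
    by (subst lborel.nn_integral_fst[symmetric]) (simp_all add: borel_prod)
  also have "\<dots> = (\<integral>\<^sup>+x. ennreal c * (\<integral>\<^sup>+h. ennreal (\<bar>f (x + h) - f x\<bar> ^ p / h\<^sup>2) \<partial>lborel) \<partial>lborel)"
  proof (rule nn_integral_cong)
    fix x :: real
    have "(\<integral>\<^sup>+h. ennreal (\<bar>f (x + h) - f x\<bar> ^ p / h\<^sup>2) \<partial>lborel)
      = ennreal c * (\<integral>\<^sup>+h. ennreal (\<bar>f (x + c * h) - f x\<bar> ^ p / (c * h)\<^sup>2) \<partial>lborel)"
      by (subst nn_integral_real_affine[where c=c and t=0]) (use c in auto)
    then have "ennreal c * (\<integral>\<^sup>+h. ennreal (\<bar>f (x + h) - f x\<bar> ^ p / h\<^sup>2) \<partial>lborel)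
      = (\<integral>\<^sup>+h. ennreal (c\<^sup>2) * ennreal (\<bar>f (x + c * h) - f x\<bar> ^ p / (c * h)\<^sup>2) \<partial>lborel)"
      by (subst nn_integral_cmult) (use c in \<open>auto simp: ennreal_mult power2_eq_square mult.assoc\<close>)
    also have "\<dots> = (\<integral>\<^sup>+h. ennreal (\<bar>f (x + c * h) - f x\<bar> ^ p / h\<^sup>2) \<partial>lborel)"
      by (intro nn_integral_cong) (use c in \<open>auto simp: ennreal_mult[symmetric] power_mult_distrib field_simps\<close>)
    finally show "(\<integral>\<^sup>+h. ennreal (\<bar>f (x + c * h) - f x\<bar> ^ p / h\<^sup>2) \<partial>lborel)
      = ennreal c * (\<integral>\<^sup>+h. ennreal (\<bar>f (x + h) - f x\<bar> ^ p / h\<^sup>2) \<partial>lborel)" by simp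
  qed
  also have "\<dots> = ennreal c * (\<integral>\<^sup>+x. (\<integral>\<^sup>+h. ennreal (\<bar>f (x + h) - f x\<bar> ^ p / h\<^sup>2) \<partial>lborel) \<partial>lborel)"
    by (subst nn_integral_cmult) auto
  also have "(\<integral>\<^sup>+x. (\<integral>\<^sup>+h. ennreal (\<bar>f (x + h) - f x\<bar> ^ p / h\<^sup>2) \<partial>lborel) \<partial>lborel)
     = (\<integral>\<^sup>+z. ennreal (\<bar>f (fst z + snd z) - f (fst z)\<bar> ^ p / (snd z)\<^sup>2) \<partial>(lborel \<Otimes>\<^sub>M lborel))"
    by (subst lborel.nn_integral_fst[symmetric]) (simp_all add: borel_prod)
  finally show ?thesis by (simp add: lborel_prod gagliardo_shift)
qed

text \<open>For fixed \<open>h\<close> the base point \<open>x + h\<close> is a translate of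
  \<open>x\<close>, so integrating in \<open>x\<close> first reduces this to the previous
  lemma.\<close>

lemma gagliardo_shift_scaled':
  assumes [measurable]: "f \<in> borel_measurable borel" and c: "c > 0"
  shows "(\<integral>\<^sup>+z. ennreal (\<bar>f (fst z + snd z + c * snd z) - f (fst z + snd z)\<bar> ^ p / (snd z)\<^sup>2) \<partial>lborel) = ennreal c * gagliardo p f"
proof -
  have "(\<integral>\<^sup>+z. ennreal (\<bar>f (fst z + snd z + c * snd z) - f (fst z + snd z)\<bar> ^ p / (snd z)\<^sup>2) \<partial>(lborel \<Otimes>\<^sub>M lborel))
    = (\<integral>\<^sup>+h. \<integral>\<^sup>+x. ennreal (\<bar>f (x + h + c * h) - f (x + h)\<bar> ^ p / h\<^sup>2) \<partial>lborel \<partial>lborel)"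
    by (subst lborel_pair.nn_integral_snd[symmetric]) (simp_all add: borel_prod case_prod_beta)
  also have "\<dots> = (\<integral>\<^sup>+h. \<integral>\<^sup>+x. ennreal (\<bar>f (x + c * h) - f x\<bar> ^ p / h\<^sup>2) \<partial>lborel \<partial>lborel)"
  proof (rule nn_integral_cong)
    fix h :: real
    show "(\<integral>\<^sup>+x. ennreal (\<bar>f (x + h + c * h) - f (x + h)\<bar> ^ p / h\<^sup>2) \<partial>lborel)
      = (\<integral>\<^sup>+x. ennreal (\<bar>f (x + c * h) - f x\<bar> ^ p / h\<^sup>2) \<partial>lborel)"
      by (subst (2) nn_integral_real_affine[where c=1 and t=h]) (auto simp: algebra_simps)
  qed
  also have "\<dots> = (\<integral>\<^sup>+z. ennreal (\<bar>f (fst z + c * snd z) - f (fst z)\<bar> ^ p / (snd z)\<^sup>2) \<partial>(lborel \<Otimes>\<^sub>M lborel))"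
    by (subst lborel_pair.nn_integral_snd[symmetric]) (simp_all add: borel_prod case_prod_beta)
  finally show ?thesis using gagliardo_shift_scaled[OF assms, of p] by (simp add: lborel_prod)
qed

text \<open>The mixed term keeps a factor \<open>(a + b + c)^2\<close> in front of
  \<open>b^2\<close>, so that \<open>b\<close> has to be controlled only in mean square, never in
  fourth power.\<close>

lemma power4_triangle:
  fixes a b c :: real
  shows "(a + b + c) ^ 4 \<le> 18 * a ^ 4 + 18 * c ^ 4 + 6 * ((a + b + c)\<^sup>2 * b\<^sup>2)"
proof -
  define l where "l = (a + b + c)\<^sup>2"
  have "0 \<le> (a - b)\<^sup>2 + (b - c)\<^sup>2 + (a - c)\<^sup>2" by simp
  then have 1: "l \<le> 3 * (a\<^sup>2 + b\<^sup>2 + c\<^sup>2)"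
    unfolding l_def by (simp add: power2_eq_square algebra_simps)
  have "l \<ge> 0" by (simp add: l_def)
  then have "l * l \<le> 3 * (l * a\<^sup>2) + 3 * (l * b\<^sup>2) + 3 * (l * c\<^sup>2)"
    using mult_left_mono[OF 1, of l] by (simp add: algebra_simps)
  \<comment> \<open>Young's inequality, weighted so that the terms with \<open>a\<close> and
    \<open>c\<close> together use up only half of \<open>l * l\<close>.\<close>
  moreover have "3 * (l * t) \<le> l * l / 4 + 9 * t\<^sup>2" for t :: real
  proof -
    have "0 \<le> (l / 2 - 3 * t)\<^sup>2" by simp
    then show ?thesis by (simp add: power2_eq_square algebra_simps)
  qed
  from this[of "a\<^sup>2"] this[of "c\<^sup>2"]
  have "3 * (l * a\<^sup>2) + 3 * (l * c\<^sup>2) \<le> l * l / 2 + 9 * a ^ 4 + 9 * c ^ 4"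
    by (simp add: power2_eq_square power4_eq_xxxx algebra_simps)
  ultimately have "l * l \<le> 18 * a ^ 4 + 18 * c ^ 4 + 6 * (l * b\<^sup>2)" by linarith
  then show ?thesis by (simp add: l_def power4_eq_xxxx power2_eq_square algebra_simps)
qed

text \<open>Averaging the two end points over intervals of length comparable to their distance \<open>h\<close>
  bounds a squared increment by the \<open>H\<^sup>1\<^sup>/\<^sup>2\<close> norm, uniformly in \<open>x\<close> and \<open>h\<close>.\<close>

lemma average_difference_bound:
  assumes [measurable]: "f \<in> borel_measurable borel" and d: "0 < d" "d \<le> 1" and h: "h \<noteq> 0"
  shows "(\<integral>\<^sup>+q. indicator ({0<..<1} \<times> {0<..<1}) q *
      ennreal ((f (x + h + d * snd q * h) - f (x + d * fst q * h))\<^sup>2) \<partial>lborel) \<le> ennreal (4 / d\<^sup>2) * gagliardo 2 f"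
proof -
  define g where "g p q = ennreal (\<bar>f p - f q\<bar>\<^sup>2 / (p - q)\<^sup>2)" for p q
  have [measurable]: "case_prod g \<in> borel_measurable (borel \<Otimes>\<^sub>M borel)"
    unfolding g_def by measurable
  have bound: "indicator ({0<..<1} \<times> {0<..<1}) q *
      ennreal ((f (x + h + d * snd q * h) - f (x + d * fst q * h))\<^sup>2)
      \<le> ennreal (4 * h\<^sup>2) * g (x + (d * h) * fst q) (x + h + (d * h) * snd q)" for q
  proof (cases "q \<in> {0<..<1} \<times> {0<..<1}")
    case True
    then obtain s t where q: "q = (s, t)" "0 < s" "s < 1" "0 < t" "t < 1" by auto
    define P where "P = x + (d * h) * s"
    define Q where "Q = x + h + (d * h) * t"
    have "Q - P = h * (1 + d * (t - s))" by (simp add: P_def Q_def algebra_simps)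
    \<comment> \<open>The perturbed end points stay within distance \<open>2 |h|\<close>, so the
      weight \<open>1 / (P - Q)^2\<close> is at least \<open>1 / (4 h^2)\<close>.\<close>
    moreover have "\<bar>d * (t - s)\<bar> \<le> 1 * 1" unfolding abs_mult
      by (intro mult_mono) (use q d in auto)
    then have "\<bar>1 + d * (t - s)\<bar> \<le> 2" by linarith
    ultimately have "\<bar>Q - P\<bar> \<le> \<bar>h\<bar> * 2" by (simp add: abs_mult mult_left_mono)
    then have "(Q - P)\<^sup>2 \<le> 4 * h\<^sup>2"
      using power_mono[of "\<bar>Q - P\<bar>" "\<bar>h\<bar> * 2" 2] by (simp add: power_mult_distrib)
    then have "(f Q - f P)\<^sup>2 \<le> 4 * h\<^sup>2 * ((f P - f Q)\<^sup>2 / (P - Q)\<^sup>2)"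
    proof (cases "P = Q")
      case False
      then have "(f P - f Q)\<^sup>2 * (P - Q)\<^sup>2 \<le> (f P - f Q)\<^sup>2 * (4 * h\<^sup>2)"
        using \<open>(Q - P)\<^sup>2 \<le> 4 * h\<^sup>2\<close> by (intro mult_left_mono) (auto simp: power2_commute)
      with False show ?thesis by (simp add: field_simps power2_commute)
    qed simp
    then show ?thesis using q
      by (auto simp: g_def P_def Q_def ennreal_mult'[symmetric] algebra_simps intro!: ennreal_leI)
  qed auto
  have "(\<integral>\<^sup>+q. indicator ({0<..<1} \<times> {0<..<1}) q *
      ennreal ((f (x + h + d * snd q * h) - f (x + d * fst q * h))\<^sup>2) \<partial>lborel)
     \<le> (\<integral>\<^sup>+q. ennreal (4 * h\<^sup>2) * g (x + (d * h) * fst q) (x + h + (d * h) * snd q) \<partial>(lborel \<Otimes>\<^sub>M lborel))"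
    unfolding lborel_prod by (intro nn_integral_mono bound)
  also have "\<dots> = ennreal (4 * h\<^sup>2) * (\<integral>\<^sup>+q. g (x + (d * h) * fst q) (x + h + (d * h) * snd q) \<partial>(lborel \<Otimes>\<^sub>M lborel))"
    by (subst nn_integral_cmult) auto
  also have "(\<integral>\<^sup>+q. g (x + (d * h) * fst q) (x + h + (d * h) * snd q) \<partial>(lborel \<Otimes>\<^sub>M lborel))
     = (\<integral>\<^sup>+s. \<integral>\<^sup>+t. g (x + (d * h) * s) (x + h + (d * h) * t) \<partial>lborel \<partial>lborel)"
    by (subst lborel.nn_integral_fst[symmetric]) simp_all
  finally have A: "(\<integral>\<^sup>+q. indicator ({0<..<1} \<times> {0<..<1}) q *
      ennreal ((f (x + h + d * snd q * h) - f (x + d * fst q * h))\<^sup>2) \<partial>lborel) \<le>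
      ennreal (4 * h\<^sup>2) * (\<integral>\<^sup>+s. \<integral>\<^sup>+t. g (x + (d * h) * s) (x + h + (d * h) * t) \<partial>lborel \<partial>lborel)" .
  \<comment> \<open>Rescaling both end points produces the Jacobian \<open>(d h)^2\<close>; it
    cancels the factor \<open>h^2\<close> and leaves the constant \<open>4 / d^2\<close>, free of
    \<open>x\<close> and \<open>h\<close>.\<close>
  have "gagliardo 2 f = (\<integral>\<^sup>+p. \<integral>\<^sup>+q. g p q \<partial>lborel \<partial>lborel)"
    by (simp add: gagliardo_def g_def)
  also have "\<dots> = ennreal \<bar>d * h\<bar> * (\<integral>\<^sup>+s. \<integral>\<^sup>+q. g (x + (d * h) * s) q \<partial>lborel \<partial>lborel)"
    using d h by (subst nn_integral_real_affine[where t=x and c="d * h"]) auto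
  also have "(\<lambda>s. \<integral>\<^sup>+q. g (x + (d * h) * s) q \<partial>lborel) = (\<lambda>s. ennreal \<bar>d * h\<bar> * (\<integral>\<^sup>+t. g (x + (d * h) * s) (x + h + (d * h) * t) \<partial>lborel))"
    using d h by (intro ext, subst nn_integral_real_affine[where t="x + h" and c="d * h"]) auto
  also have "(\<integral>\<^sup>+s. ennreal \<bar>d * h\<bar> * (\<integral>\<^sup>+t. g (x + (d * h) * s) (x + h + (d * h) * t) \<partial>lborel) \<partial>lborel)
     = ennreal \<bar>d * h\<bar> * (\<integral>\<^sup>+s. (\<integral>\<^sup>+t. g (x + (d * h) * s) (x + h + (d * h) * t) \<partial>lborel) \<partial>lborel)"
    by (subst nn_integral_cmult) auto
  finally have B: "gagliardo 2 f = ennreal \<bar>d * h\<bar> * (ennreal \<bar>d * h\<bar> * 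
     (\<integral>\<^sup>+s. (\<integral>\<^sup>+t. g (x + (d * h) * s) (x + h + (d * h) * t) \<partial>lborel) \<partial>lborel))" .
  have "ennreal u * (ennreal v * (ennreal v * I)) = ennreal (u * v * v) * I" if "u \<ge> 0" "v \<ge> 0" for u v I
    using that by (simp add: ennreal_mult mult.assoc)
  from this[of "4 / d\<^sup>2" "\<bar>d * h\<bar>"]
  have "ennreal (4 / d\<^sup>2) * (ennreal \<bar>d * h\<bar> * (ennreal \<bar>d * h\<bar> * I)) = ennreal (4 / d\<^sup>2 * \<bar>d * h\<bar> * \<bar>d * h\<bar>) * I" for I
    by simp
  moreover have "4 / d\<^sup>2 * \<bar>d * h\<bar> * \<bar>d * h\<bar> = 4 * h\<^sup>2"
    using d by (simp add: abs_mult field_simps power2_eq_square)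
  ultimately show ?thesis using A unfolding B by simp
qed

text \<open>The factor \<open>12\<close> remains after absorption, and \<open>4 * 72^2\<close> is
  the averaging constant \<open>4 / d^2\<close> for \<open>d = 1 / 72\<close>.\<close>

definition sobolev_const :: real where "sobolev_const = 12 * (4 * 72\<^sup>2)"

text \<open>Write an increment of \<open>f\<close> over \<open>h\<close> as \<open>a + b + c\<close>, where \<open>a\<close> and \<open>c\<close> are increments over at most
  \<open>h / 72\<close>. By scaling, the fourth powers of \<open>a\<close> and \<open>c\<close> together contribute at most half of the
  left-hand side and are absorbed; boundedness of \<open>f\<close> serves only to make the left-hand side finite.\<close>

lemma gagliardo_4_le_bounded:
  assumes [measurable]: "f \<in> borel_measurable borel" and M: "\<And>x. \<bar>f x\<bar> \<le> M"
    and fin: "gagliardo 2 f < \<infinity>"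
  shows "gagliardo 4 f \<le> ennreal sobolev_const * (gagliardo 2 f)\<^sup>2"
proof -
  \<comment> \<open>Chosen so that \<open>18 * d = 1 / 4\<close>: the two short increments then take
    at most a quarter of \<open>N\<close> each.\<close>
  define d :: real where "d = 1 / 72"
  define N where "N = gagliardo 4 f"
  define L where "L z = f (fst z + snd z) - f (fst z)" for z
  define b where "b q z = f (fst z + snd z + d * snd q * snd z) - f (fst z + d * fst q * snd z)" for q z
  have [measurable]: "L \<in> borel_measurable (borel :: (real \<times> real) measure)"
    unfolding L_def borel_prod[symmetric] by measurable
  have [measurable]: "case_prod b \<in> borel_measurable ((borel :: (real \<times> real) measure) \<Otimes>\<^sub>M borel)"
    unfolding b_def borel_prod[symmetric] by measurable
  have [measurable]: "(snd :: real \<times> real \<Rightarrow> real) \<in> borel_measurable borel" "(fst :: real \<times> real \<Rightarrow> real) \<in> borel_measurable borel"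
    unfolding borel_prod[symmetric] by measurable
  have M0: "M \<ge> 0" using M[of 0] by linarith
  have Nfin: "N < \<infinity>"
  proof -
    have "N \<le> (\<integral>\<^sup>+z. ennreal (4 * M\<^sup>2) * ennreal (\<bar>L z\<bar>\<^sup>2 / (snd z)\<^sup>2) \<partial>lborel)"
      unfolding N_def gagliardo_shift[OF assms(1)] L_def[symmetric]
    proof (intro nn_integral_mono)
      fix z :: "real \<times> real"
      have "\<bar>L z\<bar> \<le> 2 * M" using M[of "fst z + snd z"] M[of "fst z"] unfolding L_def by linarith
      then have "\<bar>L z\<bar>\<^sup>2 \<le> 4 * M\<^sup>2" using power_mono[of "\<bar>L z\<bar>" "2 * M" 2] by (simp add: power_mult_distrib)
      then have "\<bar>L z\<bar>\<^sup>2 * \<bar>L z\<bar>\<^sup>2 \<le> 4 * M\<^sup>2 * \<bar>L z\<bar>\<^sup>2" by (intro mult_right_mono) auto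
      then have "\<bar>L z\<bar> ^ 4 / (snd z)\<^sup>2 \<le> 4 * M\<^sup>2 * (\<bar>L z\<bar>\<^sup>2 / (snd z)\<^sup>2)"
        using divide_right_mono[of "\<bar>L z\<bar>\<^sup>2 * \<bar>L z\<bar>\<^sup>2" "4 * M\<^sup>2 * \<bar>L z\<bar>\<^sup>2" "(snd z)\<^sup>2"]
        by (simp add: power4_eq_xxxx power2_eq_square algebra_simps)
      then show "ennreal (\<bar>L z\<bar> ^ 4 / (snd z)\<^sup>2) \<le> ennreal (4 * M\<^sup>2) * ennreal (\<bar>L z\<bar>\<^sup>2 / (snd z)\<^sup>2)"
        by (subst ennreal_mult'[symmetric]) (auto intro!: ennreal_leI)
    qed
    also have "\<dots> = ennreal (4 * M\<^sup>2) * gagliardo 2 f"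
      unfolding gagliardo_shift[OF assms(1)] L_def[symmetric] by (subst nn_integral_cmult) auto
    also have "\<dots> < \<infinity>" using fin by (simp add: ennreal_mult_less_top)
    finally show ?thesis .
  qed
  define B where "B q = (\<integral>\<^sup>+z. ennreal (\<bar>L z\<bar>\<^sup>2 / (snd z)\<^sup>2) * ennreal ((b q z)\<^sup>2) \<partial>lborel)" for q
  have step: "N \<le> ennreal 12 * B q" if q: "q \<in> {0<..<1} \<times> {0<..<1}" for q
  proof -
    obtain s t where st: "q = (s, t)" "0 < s" "s < 1" "0 < t" "t < 1" using q by auto
    define a where "a z = f (fst z + (d * s) * snd z) - f (fst z)" for z
    define c where "c z = f (fst z + snd z + (d * t) * snd z) - f (fst z + snd z)" for z
    have [measurable]: "a \<in> borel_measurable borel" "c \<in> borel_measurable borel"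
      unfolding a_def c_def borel_prod[symmetric] by measurable
    have [measurable]: "b q \<in> borel_measurable borel"
      unfolding b_def borel_prod[symmetric] by measurable
    have "N \<le> (\<integral>\<^sup>+z. ennreal 18 * ennreal (\<bar>a z\<bar> ^ 4 / (snd z)\<^sup>2) + ennreal 18 * ennreal (\<bar>c z\<bar> ^ 4 / (snd z)\<^sup>2)
        + ennreal 6 * (ennreal (\<bar>L z\<bar>\<^sup>2 / (snd z)\<^sup>2) * ennreal ((b q z)\<^sup>2)) \<partial>lborel)"
      unfolding N_def gagliardo_shift[OF assms(1)] L_def[symmetric]
    proof (intro nn_integral_mono)
      fix z :: "real \<times> real"
      have "L z = a z + b q z + (- c z)"
        by (simp add: L_def a_def b_def c_def st algebra_simps)
      then have "L z ^ 4 \<le> 18 * a z ^ 4 + 18 * c z ^ 4 + 6 * ((L z)\<^sup>2 * (b q z)\<^sup>2)"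
        using power4_triangle[of "a z" "b q z" "- c z"] by simp
      then have "L z ^ 4 / (snd z)\<^sup>2 \<le> (18 * a z ^ 4 + 18 * c z ^ 4 + 6 * ((L z)\<^sup>2 * (b q z)\<^sup>2)) / (snd z)\<^sup>2"
        by (intro divide_right_mono) auto
      also have "\<dots> = 18 * (\<bar>a z\<bar> ^ 4 / (snd z)\<^sup>2) + 18 * (\<bar>c z\<bar> ^ 4 / (snd z)\<^sup>2) + 6 * ((\<bar>L z\<bar>\<^sup>2 / (snd z)\<^sup>2) * (b q z)\<^sup>2)"
        by (simp add: add_divide_distrib power_even_abs)
      finally show "ennreal (\<bar>L z\<bar> ^ 4 / (snd z)\<^sup>2) \<le> ennreal 18 * ennreal (\<bar>a z\<bar> ^ 4 / (snd z)\<^sup>2) + ennreal 18 * ennreal (\<bar>c z\<bar> ^ 4 / (snd z)\<^sup>2)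
        + ennreal 6 * (ennreal (\<bar>L z\<bar>\<^sup>2 / (snd z)\<^sup>2) * ennreal ((b q z)\<^sup>2))"
        by (simp add: ennreal_mult[symmetric] ennreal_plus[symmetric] power_even_abs ennreal_leI del: ennreal_plus ennreal_numeral)
    qed
    also have "\<dots> = ennreal 18 * (\<integral>\<^sup>+z. ennreal (\<bar>a z\<bar> ^ 4 / (snd z)\<^sup>2) \<partial>lborel) + ennreal 18 * (\<integral>\<^sup>+z. ennreal (\<bar>c z\<bar> ^ 4 / (snd z)\<^sup>2) \<partial>lborel)
        + ennreal 6 * B q"
      unfolding B_def by (simp add: nn_integral_add nn_integral_cmult del: ennreal_numeral)
    also have "(\<integral>\<^sup>+z. ennreal (\<bar>a z\<bar> ^ 4 / (snd z)\<^sup>2) \<partial>lborel) = ennreal (d * s) * N"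
      unfolding a_def N_def using st by (intro gagliardo_shift_scaled) (auto simp: d_def)
    also have "(\<integral>\<^sup>+z. ennreal (\<bar>c z\<bar> ^ 4 / (snd z)\<^sup>2) \<partial>lborel) = ennreal (d * t) * N"
      unfolding c_def N_def using st by (intro gagliardo_shift_scaled') (auto simp: d_def)
    finally have I: "N \<le> ennreal 18 * (ennreal (d * s) * N) + ennreal 18 * (ennreal (d * t) * N) + ennreal 6 * B q" .
    show ?thesis
    proof (cases "B q = \<infinity>")
      case False
      then obtain Br where Br: "B q = ennreal Br" "Br \<ge> 0" by (cases "B q") auto
      obtain Nr where Nr: "N = ennreal Nr" "Nr \<ge> 0" using Nfin by (cases N) auto
      have "Nr \<le> 18 * (d * s * Nr) + 18 * (d * t * Nr) + 6 * Br"
        using I st unfolding Br Nr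
        by (simp add: d_def ennreal_mult'[symmetric] ennreal_plus[symmetric] Br Nr ennreal_le_iff del: ennreal_plus ennreal_numeral)
      then have "Nr \<le> s * Nr / 4 + t * Nr / 4 + 6 * Br" by (simp add: d_def mult.commute)
      moreover have "s * Nr \<le> Nr" "t * Nr \<le> Nr" using st Nr by (auto intro: mult_left_le_one_le)
      ultimately have "Nr \<le> 12 * Br" using Nr(2) by linarith
      then show ?thesis unfolding Br Nr by (subst ennreal_mult'[symmetric]) (auto simp: ennreal_leI)
    qed (simp add: ennreal_mult_top)
  qed
  define Q :: "(real \<times> real) set" where "Q = {0<..<1} \<times> {0<..<1}"
  have [measurable]: "Q \<in> sets borel" unfolding Q_def borel_prod[symmetric] by measurable
  have eQ: "emeasure lborel Q = 1"
    unfolding Q_def lborel_prod[symmetric] by (subst lborel.emeasure_pair_measure_Times) auto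
  \<comment> \<open>The estimate \<open>step\<close> holds for every \<open>q\<close>, so it may be
    averaged over the unit square. After exchanging integrals the \<open>q\<close>-average is taken
    at fixed \<open>z\<close>, where the middle increment has a bound uniform in
    \<open>z\<close>.\<close>
  have "(\<integral>\<^sup>+q. (\<integral>\<^sup>+z. ennreal (\<bar>L z\<bar>\<^sup>2 / (snd z)\<^sup>2) * (indicator Q q * ennreal ((b q z)\<^sup>2)) \<partial>lborel) \<partial>lborel)
    = (\<integral>\<^sup>+z. (\<integral>\<^sup>+q. ennreal (\<bar>L z\<bar>\<^sup>2 / (snd z)\<^sup>2) * (indicator Q q * ennreal ((b q z)\<^sup>2)) \<partial>lborel) \<partial>lborel)"
    by (rule lborel_pair.Fubini') (measurable)
  also have "\<dots> = (\<integral>\<^sup>+z. ennreal (\<bar>L z\<bar>\<^sup>2 / (snd z)\<^sup>2) * (\<integral>\<^sup>+q. (indicator Q q * ennreal ((b q z)\<^sup>2)) \<partial>lborel) \<partial>lborel)"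
    by (subst nn_integral_cmult) auto
  also have "\<dots> \<le> (\<integral>\<^sup>+z. ennreal (\<bar>L z\<bar>\<^sup>2 / (snd z)\<^sup>2) * (ennreal (4 / d\<^sup>2) * gagliardo 2 f) \<partial>lborel)"
  proof (intro nn_integral_mono)
    fix z :: "real \<times> real"
    show "ennreal (\<bar>L z\<bar>\<^sup>2 / (snd z)\<^sup>2) * (\<integral>\<^sup>+q. (indicator Q q * ennreal ((b q z)\<^sup>2)) \<partial>lborel)
       \<le> ennreal (\<bar>L z\<bar>\<^sup>2 / (snd z)\<^sup>2) * (ennreal (4 / d\<^sup>2) * gagliardo 2 f)"
    proof (cases "snd z = 0")
      case False
      then show ?thesis unfolding Q_def b_def
        by (intro mult_left_mono average_difference_bound) (auto simp: d_def)
    qed simp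
  qed
  also have "\<dots> = (\<integral>\<^sup>+z. ennreal (\<bar>L z\<bar>\<^sup>2 / (snd z)\<^sup>2) \<partial>lborel) * (ennreal (4 / d\<^sup>2) * gagliardo 2 f)"
    by (subst nn_integral_multc) auto
  also have "(\<integral>\<^sup>+z. ennreal (\<bar>L z\<bar>\<^sup>2 / (snd z)\<^sup>2) \<partial>lborel) = gagliardo 2 f"
    unfolding gagliardo_shift[OF assms(1)] L_def ..
  finally have le: "(\<integral>\<^sup>+q. (\<integral>\<^sup>+z. ennreal (\<bar>L z\<bar>\<^sup>2 / (snd z)\<^sup>2) * (indicator Q q * ennreal ((b q z)\<^sup>2)) \<partial>lborel) \<partial>lborel)
    \<le> gagliardo 2 f * (ennreal (4 / d\<^sup>2) * gagliardo 2 f)" .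
  have "N = (\<integral>\<^sup>+q. N * indicator Q q \<partial>lborel)"
    using eQ by (subst nn_integral_cmult_indicator) auto
  also have "\<dots> \<le> (\<integral>\<^sup>+q. ennreal 12 * (B q * indicator Q q) \<partial>lborel)"
    using step by (intro nn_integral_mono) (auto simp: Q_def split: split_indicator)
  also have "\<dots> = ennreal 12 * (\<integral>\<^sup>+q. (\<integral>\<^sup>+z. ennreal (\<bar>L z\<bar>\<^sup>2 / (snd z)\<^sup>2) * (indicator Q q * ennreal ((b q z)\<^sup>2)) \<partial>lborel) \<partial>lborel)"
    unfolding B_def
    by (subst nn_integral_cmult, measurable, subst nn_integral_multc[symmetric], measurable) (simp add: mult_ac)
  also have "\<dots> \<le> ennreal 12 * (gagliardo 2 f * (ennreal (4 / d\<^sup>2) * gagliardo 2 f))"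
    by (intro mult_left_mono le) auto
  also have "\<dots> = (ennreal 12 * ennreal (4 / d\<^sup>2)) * (gagliardo 2 f)\<^sup>2"
    by (simp only: power2_eq_square mult_ac)
  also have "ennreal 12 * ennreal (4 / d\<^sup>2) = ennreal sobolev_const"
    by (subst ennreal_mult'[symmetric]) (auto simp: sobolev_const_def d_def field_simps)
  finally show ?thesis by (simp add: N_def)
qed

section \<open>Lower semicontinuity, and the embedding for unbounded functions\<close>

lemma nn_integral_le_limit:
  fixes f :: "nat \<Rightarrow> 'a \<Rightarrow> real"
  assumes [measurable]: "\<And>n. f n \<in> borel_measurable M"
    and lim: "AE x in M. (\<lambda>n. f n x) \<longlonglongrightarrow> g x"
    and le: "\<And>n. (\<integral>\<^sup>+x. ennreal (f n x) \<partial>M) \<le> ennreal (B n)" and B: "B \<longlonglongrightarrow> b"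
  shows "(\<integral>\<^sup>+x. ennreal (g x) \<partial>M) \<le> ennreal b"
proof -
  have "(\<integral>\<^sup>+x. ennreal (g x) \<partial>M) = (\<integral>\<^sup>+x. liminf (\<lambda>n. ennreal (f n x)) \<partial>M)"
  proof (rule nn_integral_cong_AE)
    show "AE x in M. ennreal (g x) = liminf (\<lambda>n. ennreal (f n x))"
      using lim by eventually_elim (auto intro!: lim_imp_Liminf[symmetric] tendsto_ennrealI)
  qed
  also have "\<dots> \<le> liminf (\<lambda>n. \<integral>\<^sup>+x. ennreal (f n x) \<partial>M)"
    by (rule nn_integral_liminf) measurable
  also have "\<dots> \<le> liminf (\<lambda>n. ennreal (B n))"
    by (intro Liminf_mono always_eventually allI le)
  also have "\<dots> = ennreal b"
    using B by (intro lim_imp_Liminf tendsto_ennrealI) auto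
  finally show ?thesis .
qed

text \<open>Fatou's lemma. The bounds may vary with \<open>n\<close> so that it applies to
  minimising sequences, whose excess over the infimum tends to zero.\<close>

lemma integral_le_limit:
  fixes f :: "nat \<Rightarrow> 'a \<Rightarrow> real"
  assumes f: "\<And>n. integrable M (f n)" "\<And>n x. f n x \<ge> 0"
    and g [measurable]: "g \<in> borel_measurable M" "\<And>x. g x \<ge> 0"
    and lim: "AE x in M. (\<lambda>n. f n x) \<longlonglongrightarrow> g x"
    and le: "\<And>n. (\<integral>x. f n x \<partial>M) \<le> B n" and B: "B \<longlonglongrightarrow> b"
  shows "integrable M g" "(\<integral>x. g x \<partial>M) \<le> b"
proof -
  have [measurable]: "f n \<in> borel_measurable M" for n using f(1) by auto
  have "B n \<ge> 0" for n
  proof -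
    have "0 \<le> (\<integral>x. f n x \<partial>M)" by (rule integral_nonneg_AE) (simp add: f)
    then show ?thesis using le[of n] by linarith
  qed
  then have b: "b \<ge> 0" by (intro LIMSEQ_le_const[OF B]) auto
  have nn: "(\<integral>\<^sup>+x. ennreal (g x) \<partial>M) \<le> ennreal b"
  proof (rule nn_integral_le_limit[OF _ lim _ B])
    show "(\<integral>\<^sup>+x. ennreal (f n x) \<partial>M) \<le> ennreal (B n)" for n
      using f le by (subst nn_integral_eq_integral) (auto intro: ennreal_leI)
  qed measurable
  show I: "integrable M g"
    using g nn by (intro integrableI_bounded) (auto intro: le_less_trans)
  have "ennreal (\<integral>x. g x \<partial>M) \<le> ennreal b"
    using nn_integral_eq_integral[OF I] g nn by auto
  then show "(\<integral>x. g x \<partial>M) \<le> b" using b by (simp add: ennreal_le_iff)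
qed

text \<open>Truncation to \<open>[-n, n]\<close> is 1-Lipschitz, so it does not increase the
  quadratic seminorm; Fatou removes the truncation.\<close>

lemma gagliardo_4_le:
  assumes [measurable]: "f \<in> borel_measurable borel" and fin: "gagliardo 2 f < \<infinity>"
  shows "gagliardo 4 f \<le> ennreal sobolev_const * (gagliardo 2 f)\<^sup>2"
proof -
  define T where "T n x = max (- real n) (min (real n) (f x))" for n :: nat and x
  have [measurable]: "T n \<in> borel_measurable borel" for n unfolding T_def by measurable
  have Tle: "\<bar>T n x - T n y\<bar> \<le> \<bar>f x - f y\<bar>" for n x y unfolding T_def by (auto simp: max_def min_def)
  have T2: "gagliardo 2 (T n) \<le> gagliardo 2 f" for n
    unfolding gagliardo_def
    by (intro nn_integral_mono ennreal_leI divide_right_mono power_mono Tle) auto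
  have T4: "gagliardo 4 (T n) \<le> ennreal sobolev_const * (gagliardo 2 f)\<^sup>2" for n
  proof -
    have "gagliardo 4 (T n) \<le> ennreal sobolev_const * (gagliardo 2 (T n))\<^sup>2"
      using T2[of n] fin by (intro gagliardo_4_le_bounded[of _ "real n"]) (auto simp: T_def max_def min_def intro: le_less_trans)
    also have "\<dots> \<le> ennreal sobolev_const * (gagliardo 2 f)\<^sup>2"
      by (intro mult_left_mono power_mono T2) auto
    finally show ?thesis .
  qed
  have lim: "(\<lambda>n. T n x) \<longlonglongrightarrow> f x" for x
  proof (rule tendsto_eventually)
    obtain n0 :: nat where "\<bar>f x\<bar> \<le> real n0" using real_arch_simple by blast
    then show "\<forall>\<^sub>F n in sequentially. T n x = f x"
      unfolding eventually_sequentially by (intro exI[of _ n0]) (auto simp: T_def)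
  qed
  obtain b where b: "ennreal sobolev_const * (gagliardo 2 f)\<^sup>2 = ennreal b" "b \<ge> 0"
    using fin by (cases "ennreal sobolev_const * (gagliardo 2 f)\<^sup>2")
      (auto simp: ennreal_mult_eq_top_iff power2_eq_square)
  have conv: "gagliardo 4 h = (\<integral>\<^sup>+z. ennreal (\<bar>h (fst z) - h (snd z)\<bar> ^ 4 / (fst z - snd z)\<^sup>2) \<partial>(lborel \<Otimes>\<^sub>M lborel))"
    if [measurable]: "h \<in> borel_measurable borel" for h
    unfolding gagliardo_def by (subst lborel.nn_integral_fst[symmetric]) auto
  have "gagliardo 4 f \<le> ennreal b"
    unfolding conv[OF assms(1)]
  proof (rule nn_integral_le_limit)
    show "AE z in lborel \<Otimes>\<^sub>M lborel. (\<lambda>n. \<bar>T n (fst z) - T n (snd z)\<bar> ^ 4 / (fst z - snd z)\<^sup>2) \<longlonglongrightarrow> \<bar>f (fst z) - f (snd z)\<bar> ^ 4 / (fst z - snd z)\<^sup>2"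
    proof (rule AE_I2)
      fix z :: "real \<times> real"
      show "(\<lambda>n. \<bar>T n (fst z) - T n (snd z)\<bar> ^ 4 / (fst z - snd z)\<^sup>2) \<longlonglongrightarrow> \<bar>f (fst z) - f (snd z)\<bar> ^ 4 / (fst z - snd z)\<^sup>2"
        unfolding divide_inverse by (intro tendsto_intros lim)
    qed
    show "(\<integral>\<^sup>+z. ennreal (\<bar>T n (fst z) - T n (snd z)\<bar> ^ 4 / (fst z - snd z)\<^sup>2) \<partial>(lborel \<Otimes>\<^sub>M lborel)) \<le> ennreal b" for n
      using T4[of n] unfolding conv[OF \<open>T n \<in> borel_measurable borel\<close>] b .
  qed (auto intro: tendsto_const)
  then show ?thesis unfolding b .
qed

text \<open>The Moebius invariant measure on pairs of boundary points of the hyperbolic plane. It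
  turns the Gagliardo seminorms into \<open>L^p\<close> norms of increments; the density is
  \<open>1 / 0 = 0\<close> on the diagonal.\<close>

definition hyp :: "(real \<times> real) measure" where
  "hyp = density lborel (\<lambda>z. ennreal (1 / (fst z - snd z)\<^sup>2))"

abbreviation incr :: "(real \<Rightarrow> real) \<Rightarrow> real \<times> real \<Rightarrow> real" where
  "incr f z \<equiv> f (fst z) - f (snd z)"

definition h_half :: "(real \<Rightarrow> real) set" where
  "h_half = {f \<in> borel_measurable borel. integrable hyp (\<lambda>z. (incr f z)\<^sup>2)}"

definition sq_norm :: "(real \<Rightarrow> real) \<Rightarrow> real" where
  "sq_norm f = (\<integral>z. (incr f z)\<^sup>2 \<partial>hyp)"

lemma measurable_fst_snd_real [measurable]:
  "(fst :: real \<times> real \<Rightarrow> real) \<in> borel_measurable borel"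
  "(snd :: real \<times> real \<Rightarrow> real) \<in> borel_measurable borel"
  unfolding borel_prod[symmetric] by measurable

lemma sets_hyp [measurable_cong, simp]: "sets hyp = sets borel"
  by (simp add: hyp_def)

lemma measurable_hyp_compose [measurable (raw)]:
  fixes f :: "real \<Rightarrow> real"
  assumes "f \<in> borel_measurable borel"
  shows "(\<lambda>z :: real \<times> real. f (fst z)) \<in> borel_measurable borel"
    "(\<lambda>z :: real \<times> real. f (snd z)) \<in> borel_measurable borel"
    "(\<lambda>z. f (fst z)) \<in> borel_measurable hyp" "(\<lambda>z. f (snd z)) \<in> borel_measurable hyp"
proof -
  show *: "(\<lambda>z :: real \<times> real. f (fst z)) \<in> borel_measurable borel"
    "(\<lambda>z :: real \<times> real. f (snd z)) \<in> borel_measurable borel"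
    by (intro measurable_compose[OF measurable_fst_snd_real(1) assms] measurable_compose[OF measurable_fst_snd_real(2) assms])+
  then show "(\<lambda>z. f (fst z)) \<in> borel_measurable hyp" "(\<lambda>z. f (snd z)) \<in> borel_measurable hyp"
    by (simp_all add: measurable_cong_sets[OF sets_hyp refl])
qed

lemma nn_integral_hyp:
  assumes [measurable]: "g \<in> borel_measurable borel"
  shows "(\<integral>\<^sup>+z. ennreal (g z) \<partial>hyp) = (\<integral>\<^sup>+x. \<integral>\<^sup>+y. ennreal (g (x, y) / (x - y)\<^sup>2) \<partial>lborel \<partial>lborel)"
proof -
  have [measurable]: "g \<in> borel_measurable (borel \<Otimes>\<^sub>M borel)" by (simp add: borel_prod)
  have "(\<integral>\<^sup>+z. ennreal (g z) \<partial>hyp) = (\<integral>\<^sup>+z. ennreal (1 / (fst z - snd z)\<^sup>2) * ennreal (g z) \<partial>lborel)"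
    unfolding hyp_def by (subst nn_integral_density) auto
  also have "\<dots> = (\<integral>\<^sup>+z. ennreal (g z / (fst z - snd z)\<^sup>2) \<partial>(lborel \<Otimes>\<^sub>M lborel))"
    unfolding lborel_prod by (intro nn_integral_cong) (subst ennreal_mult'[symmetric], auto)
  also have "\<dots> = (\<integral>\<^sup>+x. \<integral>\<^sup>+y. ennreal (g (x, y) / (x - y)\<^sup>2) \<partial>lborel \<partial>lborel)"
    by (subst lborel.nn_integral_fst[symmetric]) auto
  finally show ?thesis .
qed

lemma gagliardo_eq_hyp:
  assumes [measurable]: "f \<in> borel_measurable borel"
  shows "gagliardo p f = (\<integral>\<^sup>+z. ennreal (\<bar>incr f z\<bar> ^ p) \<partial>hyp)"
  unfolding gagliardo_def by (subst nn_integral_hyp) auto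

lemma h_half_gagliardo:
  assumes "f \<in> h_half" shows "gagliardo 2 f = ennreal (sq_norm f)"
proof -
  have f [measurable]: "f \<in> borel_measurable borel" using assms by (simp add: h_half_def)
  show ?thesis using assms
    unfolding gagliardo_eq_hyp[OF f] sq_norm_def h_half_def by (subst nn_integral_eq_integral) auto
qed

lemma h_halfI:
  assumes [measurable]: "f \<in> borel_measurable borel" and "gagliardo 2 f \<le> ennreal B" and B: "B \<ge> 0"
  shows "f \<in> h_half" "sq_norm f \<le> B"
proof -
  have "integrable hyp (\<lambda>z. (incr f z)\<^sup>2)"
    using assms(2) by (intro integrableI_bounded) (auto simp: gagliardo_eq_hyp intro: le_less_trans)
  then show f: "f \<in> h_half" by (simp add: h_half_def)
  show "sq_norm f \<le> B" using assms(2) B by (simp add: h_half_gagliardo[OF f] ennreal_le_iff)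
qed

lemma sq_norm_nonneg: "sq_norm f \<ge> 0" by (simp add: sq_norm_def)

lemma h_half_power4:
  assumes "f \<in> h_half"
  shows "integrable hyp (\<lambda>z. incr f z ^ 4)" "(\<integral>z. incr f z ^ 4 \<partial>hyp) \<le> sobolev_const * (sq_norm f)\<^sup>2"
proof -
  have f [measurable]: "f \<in> borel_measurable borel" using assms by (simp add: h_half_def)
  have "gagliardo 4 f \<le> ennreal sobolev_const * (gagliardo 2 f)\<^sup>2"
    by (intro gagliardo_4_le) (auto simp: h_half_gagliardo assms)
  then have "gagliardo 4 f \<le> ennreal (sobolev_const * (sq_norm f)\<^sup>2)"
    by (simp add: h_half_gagliardo[OF assms] ennreal_mult' ennreal_power sq_norm_nonneg sobolev_const_def)
  then have le: "(\<integral>\<^sup>+z. ennreal (incr f z ^ 4) \<partial>hyp) \<le> ennreal (sobolev_const * (sq_norm f)\<^sup>2)"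
    by (simp add: gagliardo_eq_hyp power_even_abs)
  show I: "integrable hyp (\<lambda>z. incr f z ^ 4)"
    using le by (intro integrableI_bounded) (auto intro: le_less_trans)
  show "(\<integral>z. incr f z ^ 4 \<partial>hyp) \<le> sobolev_const * (sq_norm f)\<^sup>2"
    using le nn_integral_eq_integral[OF I] by (simp add: ennreal_le_iff sobolev_const_def)
qed

subsection \<open>The energy of a phase\<close>

lemma one_minus_cos_le: "1 - cos x \<le> x\<^sup>2 / 2" for x :: real
proof -
  have "cos x = 1 - 2 * (sin (x / 2))\<^sup>2" using cos_double_sin[of "x / 2"] by simp
  moreover have "(sin (x / 2))\<^sup>2 \<le> (x / 2)\<^sup>2"
    using abs_sin_x_le_abs_x[of "x / 2"] unfolding abs_le_square_iff .
  ultimately show ?thesis by (simp add: power2_eq_square)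
qed

lemma one_minus_cos_ge: "1 - cos x \<ge> x\<^sup>2 / 2 - x ^ 4 / 24" for x :: real
proof -
  obtain t where "cos x = (\<Sum>m<4. cos_coeff m * x ^ m) + cos (t + 1 / 2 * real 4 * pi) / fact 4 * x ^ 4"
    using Maclaurin_cos_expansion[of x 4] by blast
  moreover have "(\<Sum>m<4. g m) = g 0 + g 1 + g 2 + g 3" for g :: "nat \<Rightarrow> real"
    by (simp add: numeral_eq_Suc)
  moreover have "cos_coeff 0 = 1" "cos_coeff 1 = 0" "cos_coeff 2 = - 1 / 2" "cos_coeff 3 = 0"
    by (simp_all add: cos_coeff_def fact_numeral)
  ultimately have "cos x = 1 - x\<^sup>2 / 2 + cos (t + 2 * pi) / 24 * x ^ 4"
    by (simp add: fact_numeral)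
  moreover have "cos (t + 2 * pi) / 24 * x ^ 4 \<le> 1 / 24 * x ^ 4"
    by (intro mult_right_mono) auto
  ultimately show ?thesis by simp
qed

text \<open>The convexity defect is exactly \<open>cos m * (1 - cos d)\<close>. Its main part is
  \<open>d^2 / 2\<close>; replacing \<open>cos m\<close> by its lower bound
  \<open>1 - m^2 / 2\<close> costs the mixed quartic term.\<close>

lemma cos_midpoint:
  fixes m d :: real
  shows "((1 - cos (m + d)) + (1 - cos (m - d))) / 2 - (1 - cos m) \<ge> d\<^sup>2 / 2 - d ^ 4 / 24 - m\<^sup>2 * d\<^sup>2 / 4"
proof -
  have "((1 - cos (m + d)) + (1 - cos (m - d))) / 2 - (1 - cos m) = cos m * (1 - cos d)"
    by (simp add: cos_add cos_diff field_simps)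
  moreover have "cos m * (1 - cos d) \<ge> (1 - m\<^sup>2 / 2) * (1 - cos d)"
    using one_minus_cos_le[of m] by (intro mult_right_mono) auto
  moreover have "m\<^sup>2 / 2 * (1 - cos d) \<le> m\<^sup>2 * d\<^sup>2 / 4"
    using mult_left_mono[OF one_minus_cos_le[of d], of "m\<^sup>2 / 2"] by simp
  moreover have "(1 - m\<^sup>2 / 2) * (1 - cos d) = (1 - cos d) - m\<^sup>2 / 2 * (1 - cos d)" by (simp add: algebra_simps)
  ultimately show ?thesis using one_minus_cos_ge[of d] by linarith
qed

text \<open>For \<open>u = exp (i f)\<close> this is \<open>\<pi>\<close> times the energy \<open>E u\<close>.\<close>

definition energy :: "(real \<Rightarrow> real) \<Rightarrow> real" where
  "energy f = (\<integral>z. 1 - cos (incr f z) \<partial>hyp)"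

lemma integrable_energy:
  assumes "f \<in> h_half" shows "integrable hyp (\<lambda>z. 1 - cos (incr f z))"
proof (rule Bochner_Integration.integrable_bound)
  have [measurable]: "f \<in> borel_measurable borel" using assms by (simp add: h_half_def)
  show "integrable hyp (\<lambda>z. (incr f z)\<^sup>2)" using assms by (simp add: h_half_def)
  show "(\<lambda>z. 1 - cos (incr f z)) \<in> borel_measurable hyp" by measurable
  have "1 - cos x \<le> x\<^sup>2" for x :: real using one_minus_cos_le[of x] zero_le_power2[of x] by linarith
  then show "AE z in hyp. norm (1 - cos (incr f z)) \<le> norm ((incr f z)\<^sup>2)" by simp
qed

lemma energy_nonneg: "energy f \<ge> 0"
  unfolding energy_def by (intro integral_nonneg_AE AE_I2) auto

lemma energy_le:
  assumes "f \<in> h_half" shows "energy f \<le> sq_norm f / 2"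
proof -
  have "energy f \<le> (\<integral>z. (incr f z)\<^sup>2 / 2 \<partial>hyp)"
    unfolding energy_def using assms
    by (intro integral_mono integrable_energy one_minus_cos_le) (auto simp: h_half_def)
  then show ?thesis by (simp add: sq_norm_def)
qed

text \<open>Coercivity: the quartic correction is at most \<open>1 / 24\<close> of
  \<open>sq_norm f\<close> by the embedding. Together with \<open>energy_le\<close> this keeps
  minimisers off the boundary of the ball.\<close>

lemma energy_ge:
  assumes f: "f \<in> h_half" and "sobolev_const * sq_norm f \<le> 1"
  shows "energy f \<ge> sq_norm f / 4"
proof -
  note I = h_half_power4[OF f]
  have I2: "integrable hyp (\<lambda>z. (incr f z)\<^sup>2)" using f by (simp add: h_half_def)
  have "(\<integral>z. (incr f z)\<^sup>2 / 2 - incr f z ^ 4 / 24 \<partial>hyp) \<le> energy f"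
    unfolding energy_def using I I2
    by (intro integral_mono integrable_energy f one_minus_cos_ge) auto
  also have "(\<integral>z. (incr f z)\<^sup>2 / 2 - incr f z ^ 4 / 24 \<partial>hyp) = sq_norm f / 2 - (\<integral>z. incr f z ^ 4 \<partial>hyp) / 24"
    using I I2 by (simp add: sq_norm_def)
  finally have "sq_norm f / 2 - sobolev_const * (sq_norm f)\<^sup>2 / 24 \<le> energy f" using I(2) by simp
  moreover have "sobolev_const * (sq_norm f)\<^sup>2 \<le> 1 * sq_norm f"
    using mult_right_mono[OF assms(2) sq_norm_nonneg[of f]] by (simp add: power2_eq_square mult.assoc)
  ultimately show ?thesis using sq_norm_nonneg[of f] by linarith
qed

section \<open>Bilinear structure, parallelogram law and convexity of the energy\<close>

lemma h_half_lincomb: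
  assumes f: "f \<in> h_half" and g: "g \<in> h_half"
  shows "(\<lambda>x. a * f x + b * g x) \<in> h_half"
    "integrable hyp (\<lambda>z. incr f z * incr g z)"
    "sq_norm (\<lambda>x. a * f x + b * g x) = a\<^sup>2 * sq_norm f + 2 * a * b * (\<integral>z. incr f z * incr g z \<partial>hyp) + b\<^sup>2 * sq_norm g"
proof -
  have [measurable]: "f \<in> borel_measurable borel" "g \<in> borel_measurable borel" using assms by (auto simp: h_half_def)
  have I: "integrable hyp (\<lambda>z. (incr f z)\<^sup>2)" "integrable hyp (\<lambda>z. (incr g z)\<^sup>2)"
    using assms by (auto simp: h_half_def)
  show J: "integrable hyp (\<lambda>z. incr f z * incr g z)"
  proof (rule Bochner_Integration.integrable_bound)
    show "integrable hyp (\<lambda>z. (incr f z)\<^sup>2 + (incr g z)\<^sup>2)" using I by auto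
    have "\<bar>x * y\<bar> \<le> x\<^sup>2 + y\<^sup>2" for x y :: real
    proof -
      have "0 \<le> \<bar>x\<bar> * \<bar>y\<bar>" by simp
      moreover have "2 * (\<bar>x\<bar> * \<bar>y\<bar>) \<le> x\<^sup>2 + y\<^sup>2"
        using sum_squares_bound[of "\<bar>x\<bar>" "\<bar>y\<bar>"] by simp
      ultimately show ?thesis unfolding abs_mult by linarith
    qed
    then show "AE z in hyp. norm (incr f z * incr g z) \<le> norm ((incr f z)\<^sup>2 + (incr g z)\<^sup>2)" by simp
  qed measurable
  have eq: "(incr (\<lambda>x. a * f x + b * g x) z)\<^sup>2 = a\<^sup>2 * (incr f z)\<^sup>2 + 2 * a * b * (incr f z * incr g z) + b\<^sup>2 * (incr g z)\<^sup>2" for z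
    by (simp add: power2_eq_square algebra_simps)
  show "(\<lambda>x. a * f x + b * g x) \<in> h_half" unfolding h_half_def mem_Collect_eq eq using I J by auto
  show "sq_norm (\<lambda>x. a * f x + b * g x) = a\<^sup>2 * sq_norm f + 2 * a * b * (\<integral>z. incr f z * incr g z \<partial>hyp) + b\<^sup>2 * sq_norm g"
    unfolding sq_norm_def eq using I J by simp
qed

lemma sq_norm_scale: "sq_norm (\<lambda>x. c * f x) = c\<^sup>2 * sq_norm f"
  unfolding sq_norm_def by (subst integral_mult_right_zero[symmetric]) (simp add: power2_eq_square algebra_simps)

lemma sq_norm_midpoint:
  assumes f: "f \<in> h_half" and g: "g \<in> h_half"
  shows "sq_norm (\<lambda>x. 1/2 * f x + 1/2 * g x) + sq_norm (\<lambda>x. 1/2 * f x + -(1/2) * g x) = (sq_norm f + sq_norm g) / 2"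
  unfolding h_half_lincomb(3)[OF f g] by (simp add: power2_eq_square)

text \<open>Uniform convexity on small balls: the error terms in \<open>cos_midpoint\<close> are quartic, hence small by
  the embedding \<open>h_half_power4\<close>.\<close>

lemma energy_midpoint:
  assumes f: "f \<in> h_half" "sq_norm f \<le> r" and g: "g \<in> h_half" "sq_norm g \<le> r"
    and r: "sobolev_const * r \<le> 1 / 2" "r > 0"
  defines "m \<equiv> \<lambda>x. 1/2 * f x + 1/2 * g x" and "d \<equiv> \<lambda>x. 1/2 * f x + -(1/2) * g x"
  assumes pos: "sq_norm d > 0"
  shows "energy m \<le> (energy f + energy g) / 2 - sq_norm d / 4"
proof -
  have m: "m \<in> h_half" and d: "d \<in> h_half" unfolding m_def d_def by (intro h_half_lincomb f g)+
  have [measurable]: "m \<in> borel_measurable borel" "d \<in> borel_measurable borel" using m d by (auto simp: h_half_def)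
  define A where "A = sq_norm d"
  have A: "0 < A" "A \<le> r" and mr: "sq_norm m \<le> r"
    using sq_norm_midpoint[OF f(1) g(1), folded m_def d_def] sq_norm_nonneg[of m] sq_norm_nonneg[of d] f g pos
    by (auto simp: A_def)
  note I = h_half_power4[OF m] h_half_power4[OF d]
  have Id: "integrable hyp (\<lambda>z. (incr d z)\<^sup>2)" using d by (simp add: h_half_def)
  \<comment> \<open>The weight in Young's inequality that balances the two quartic bounds: each
    contributes \<open>sobolev_const * r * A / 2\<close>, linear in \<open>A\<close> as
    required.\<close>
  define l where "l = A / r"
  have l: "l > 0" using A r by (simp add: l_def)
  have young: "x\<^sup>2 * y\<^sup>2 \<le> l / 2 * x ^ 4 + y ^ 4 / (2 * l)" for x y :: real
  proof -
    have "0 \<le> (l * x\<^sup>2 - y\<^sup>2)\<^sup>2 / (2 * l)" using l by auto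
    also have "\<dots> = l / 2 * x ^ 4 + y ^ 4 / (2 * l) - x\<^sup>2 * y\<^sup>2"
      using l by (simp add: power2_eq_square power4_eq_xxxx field_simps)
    finally show ?thesis by simp
  qed
  have IR: "integrable hyp (\<lambda>z. l / 2 * incr m z ^ 4 + incr d z ^ 4 / (2 * l))"
    using I by auto
  have Imd: "integrable hyp (\<lambda>z. (incr m z)\<^sup>2 * (incr d z)\<^sup>2)"
    by (rule Bochner_Integration.integrable_bound[OF IR])
       (measurable, use young l in \<open>auto intro!: AE_I2 simp: order_trans[OF young]\<close>)
  have "(\<integral>z. (incr m z)\<^sup>2 * (incr d z)\<^sup>2 \<partial>hyp) \<le> (\<integral>z. l / 2 * incr m z ^ 4 + incr d z ^ 4 / (2 * l) \<partial>hyp)"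
    by (intro integral_mono Imd IR young)
  also have "\<dots> = l / 2 * (\<integral>z. incr m z ^ 4 \<partial>hyp) + (\<integral>z. incr d z ^ 4 \<partial>hyp) / (2 * l)"
    using I by simp
  also have "\<dots> \<le> l / 2 * (sobolev_const * r\<^sup>2) + sobolev_const * A\<^sup>2 / (2 * l)"
  proof (intro add_mono mult_left_mono divide_right_mono)
    have "sobolev_const * (sq_norm m)\<^sup>2 \<le> sobolev_const * r\<^sup>2"
      using mr sq_norm_nonneg[of m] by (intro mult_left_mono power_mono) (auto simp: sobolev_const_def)
    then show "(\<integral>z. incr m z ^ 4 \<partial>hyp) \<le> sobolev_const * r\<^sup>2" using I(2) by linarith
    show "(\<integral>z. incr d z ^ 4 \<partial>hyp) \<le> sobolev_const * A\<^sup>2" using I(4) by (simp add: A_def)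
  qed (use l in auto)
  also have "\<dots> = (sobolev_const * r) * A"
    using A r by (simp add: l_def power2_eq_square field_simps)
  also have "\<dots> \<le> 1 / 2 * A" using A r by (intro mult_right_mono) auto
  finally have md: "(\<integral>z. (incr m z)\<^sup>2 * (incr d z)\<^sup>2 \<partial>hyp) \<le> A / 2" by simp
  have "sobolev_const * A * A \<le> sobolev_const * r * A"
    using A by (intro mult_right_mono mult_left_mono) (auto simp: sobolev_const_def)
  also have "\<dots> \<le> 1 / 2 * A" using A r by (intro mult_right_mono) auto
  finally have d4: "(\<integral>z. incr d z ^ 4 \<partial>hyp) \<le> A / 2"
    using I(4) by (simp add: A_def power2_eq_square mult.assoc)
  have eq: "incr f z = incr m z + incr d z" "incr g z = incr m z - incr d z" for z
    by (auto simp: m_def d_def field_simps)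
  have E: "has_bochner_integral hyp (\<lambda>z. 1 - cos (incr h z)) (energy h)" if "h \<in> h_half" for h
    using integrable_energy[OF that] by (simp add: energy_def has_bochner_integral_iff)
  have If: "has_bochner_integral hyp (\<lambda>z. ((1 - cos (incr f z)) + (1 - cos (incr g z))) / 2 - (1 - cos (incr m z)))
      ((energy f + energy g) / 2 - energy m)"
    by (intro has_bochner_integral_diff[OF has_bochner_integral_divide_zero[OF has_bochner_integral_add]] E f g m)
  have "A / 2 - (\<integral>z. incr d z ^ 4 \<partial>hyp) / 24 - (\<integral>z. (incr m z)\<^sup>2 * (incr d z)\<^sup>2 \<partial>hyp) / 4
    = (\<integral>z. (incr d z)\<^sup>2 / 2 - incr d z ^ 4 / 24 - (incr m z)\<^sup>2 * (incr d z)\<^sup>2 / 4 \<partial>hyp)"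
    using I Id Imd by (simp add: A_def sq_norm_def)
  also have "\<dots> \<le> (\<integral>z. ((1 - cos (incr f z)) + (1 - cos (incr g z))) / 2 - (1 - cos (incr m z)) \<partial>hyp)"
  proof (rule integral_mono)
    show "(incr d z)\<^sup>2 / 2 - incr d z ^ 4 / 24 - (incr m z)\<^sup>2 * (incr d z)\<^sup>2 / 4
       \<le> ((1 - cos (incr f z)) + (1 - cos (incr g z))) / 2 - (1 - cos (incr m z))" for z
      unfolding eq using cos_midpoint by auto
  qed (use I Id Imd If in \<open>auto simp: has_bochner_integral_iff\<close>)
  also have "\<dots> = (energy f + energy g) / 2 - energy m"
    using If by (rule has_bochner_integral_integral_eq)
  \<comment> \<open>The coefficient left in front of \<open>A\<close> is
    \<open>1/2 - 1/48 - 1/8\<close>, which exceeds \<open>1/4\<close>.\<close>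
  finally show ?thesis using md d4 A by (simp add: A_def[symmetric])
qed

subsection \<open>Minimisers of small energy\<close>

text \<open>One family serves three purposes: \<open>c = 2 \<pi> n\<close> for phases,
  \<open>c = 1\<close> for cutoffs and \<open>c = 0\<close> for variations and test functions. The
  constraints hold at every point, so they survive linear combinations literally.\<close>

definition admissible :: "real \<Rightarrow> real \<Rightarrow> (real \<Rightarrow> real) set" where
  "admissible a c = {f \<in> h_half. (\<forall>x. x \<notin> {-1<..<1} \<longrightarrow> f x = 0) \<and> (\<forall>x\<in>{-a..a}. f x = c)}"

lemma h_half_measurable: "f \<in> h_half \<Longrightarrow> f \<in> borel_measurable borel"
  by (simp add: h_half_def)

text \<open>A point \<open>x\<close> of \<open>(-1, 1)\<close> is compared with all \<open>y\<close>
  in \<open>[1, 2]\<close>, where \<open>f\<close> vanishes: that interval has length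
  \<open>1\<close> and lies within distance \<open>3\<close>, whence the constant
  \<open>9\<close>.\<close>

lemma poincare:
  assumes f: "f \<in> h_half" and out: "\<And>x. x \<notin> {-1<..<1} \<Longrightarrow> f x = 0"
  shows "integrable lborel (\<lambda>x. (f x)\<^sup>2)" "(\<integral>x. (f x)\<^sup>2 \<partial>lborel) \<le> 9 * sq_norm f"
proof -
  note [measurable] = h_half_measurable[OF f]
  have "(\<integral>\<^sup>+x. ennreal ((f x)\<^sup>2 / 9) \<partial>lborel) \<le> gagliardo 2 f"
    unfolding gagliardo_def
  proof (rule nn_integral_mono)
    fix x :: real
    show "ennreal ((f x)\<^sup>2 / 9) \<le> (\<integral>\<^sup>+y. ennreal (\<bar>f x - f y\<bar>\<^sup>2 / (x - y)\<^sup>2) \<partial>lborel)"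
    proof (cases "x \<in> {-1<..<1}")
      case True
      have "ennreal ((f x)\<^sup>2 / 9) = (\<integral>\<^sup>+y. ennreal ((f x)\<^sup>2 / 9) * indicator {1..2::real} y \<partial>lborel)"
        by (subst nn_integral_cmult_indicator) auto
      also have "\<dots> \<le> (\<integral>\<^sup>+y. ennreal (\<bar>f x - f y\<bar>\<^sup>2 / (x - y)\<^sup>2) \<partial>lborel)"
      proof (rule nn_integral_mono)
        fix y :: real
        show "ennreal ((f x)\<^sup>2 / 9) * indicator {1..2} y \<le> ennreal (\<bar>f x - f y\<bar>\<^sup>2 / (x - y)\<^sup>2)"
        proof (cases "y \<in> {1..2}")
          case y: True
          have "f y = 0" using y by (intro out) auto
          have "(y - x)\<^sup>2 \<le> 3\<^sup>2" using True y by (intro power_mono) auto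
          then have "(x - y)\<^sup>2 \<le> 9" "(x - y)\<^sup>2 > 0" using True y by (auto simp: power2_commute)
          then have "(f x)\<^sup>2 / 9 \<le> (f x)\<^sup>2 / (x - y)\<^sup>2" by (intro divide_left_mono) auto
          then show ?thesis using y \<open>f y = 0\<close> by (simp add: ennreal_leI)
        qed simp
      qed
      finally show ?thesis .
    qed (simp add: out)
  qed
  also have "\<dots> = ennreal (sq_norm f)" by (rule h_half_gagliardo[OF f])
  finally have le: "(\<integral>\<^sup>+x. ennreal ((f x)\<^sup>2 / 9) \<partial>lborel) \<le> ennreal (sq_norm f)" .
  then have I: "integrable lborel (\<lambda>x. (f x)\<^sup>2 / 9)"
    by (intro integrableI_bounded) (auto intro: le_less_trans)
  have "integrable lborel (\<lambda>x. 9 * ((f x)\<^sup>2 / 9))" by (intro integrable_mult_right I)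
  then show "integrable lborel (\<lambda>x. (f x)\<^sup>2)" by simp
  have "(\<integral>x. (f x)\<^sup>2 / 9 \<partial>lborel) \<le> sq_norm f"
    using le nn_integral_eq_integral[OF I] by (simp add: ennreal_le_iff sq_norm_nonneg)
  then show "(\<integral>x. (f x)\<^sup>2 \<partial>lborel) \<le> 9 * sq_norm f" by simp
qed

text \<open>The free parameter \<open>e\<close> replaces a square root: a small
  \<open>sq_norm\<close> gives a small \<open>L^1\<close> norm once \<open>e\<close> is chosen
  accordingly.\<close>

lemma poincare_L1:
  assumes f: "f \<in> h_half" and out: "\<And>x. x \<notin> {-1<..<1} \<Longrightarrow> f x = 0" and e: "e > 0"
  shows "integrable lborel f" "(\<integral>x. \<bar>f x\<bar> \<partial>lborel) \<le> e + 9 * sq_norm f / (2 * e)"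
proof -
  note [measurable] = h_half_measurable[OF f]
  note I = poincare[OF f out]
  have J: "integrable lborel (\<lambda>x. e / 2 * indicat_real {-1<..<1::real} x)"
    by (intro integrable_mult_right integrable_real_indicator) auto
  have le: "\<bar>f x\<bar> \<le> e / 2 * indicat_real {-1<..<1::real} x + (f x)\<^sup>2 / (2 * e)" for x
  proof (cases "x \<in> {-1<..<1}")
    case True
    have "0 \<le> (e - \<bar>f x\<bar>)\<^sup>2 / (2 * e)" using e by auto
    also have "\<dots> = e / 2 + (f x)\<^sup>2 / (2 * e) - \<bar>f x\<bar>" using e by (simp add: power2_eq_square field_simps)
    finally show ?thesis using True by simp
  qed (use e in \<open>simp add: out\<close>)
  have K: "integrable lborel (\<lambda>x. e / 2 * indicat_real {-1<..<1::real} x + (f x)\<^sup>2 / (2 * e))"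
    using I J by auto
  show L: "integrable lborel f"
    by (rule Bochner_Integration.integrable_bound[OF K]) (use le in \<open>auto intro!: AE_I2 intro: order_trans[OF le]\<close>)
  have "(\<integral>x. \<bar>f x\<bar> \<partial>lborel) \<le> (\<integral>x. e / 2 * indicat_real {-1<..<1::real} x + (f x)\<^sup>2 / (2 * e) \<partial>lborel)"
    using L by (intro integral_mono K le) auto
  also have "\<dots> = e + (\<integral>x. (f x)\<^sup>2 \<partial>lborel) / (2 * e)"
    using I J by simp
  also have "\<dots> \<le> e + 9 * sq_norm f / (2 * e)"
    using I e by (intro add_left_mono divide_right_mono) auto
  finally show "(\<integral>x. \<bar>f x\<bar> \<partial>lborel) \<le> e + 9 * sq_norm f / (2 * e)" .
qed

lemma AE_hyp:
  assumes "AE x in lborel. P x"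
  shows "AE z in hyp. P (fst z) \<and> P (snd z)"
proof -
  obtain N where N: "{x. \<not> P x} \<subseteq> N" "N \<in> sets borel" "emeasure lborel N = 0"
    using assms by (auto simp: eventually_ae_filter null_sets_def)
  note [measurable] = N(2)
  have "AE x in lborel. x \<notin> N" using N by (intro AE_not_in) (auto simp: null_sets_def)
  then have "AE z in lborel \<Otimes>\<^sub>M lborel. fst z \<notin> N \<and> snd z \<notin> N"
    by (intro lborel_pair.AE_pair_measure) (measurable, auto)
  then have "AE z in lborel. P (fst z) \<and> P (snd z)"
    unfolding lborel_prod by eventually_elim (use N in auto)
  then show ?thesis unfolding hyp_def by (subst AE_density) auto
qed

lemma admissible_average:
  assumes "f \<in> admissible a c" "g \<in> admissible a c"
  shows "(\<lambda>x. 1/2 * f x + 1/2 * g x) \<in> admissible a c"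
  using assms h_half_lincomb(1)[of f g "1/2" "1/2"] by (auto simp: admissible_def)

lemma h_half_limit:
  assumes f: "\<And>n. f n \<in> h_half" and g: "g \<in> borel_measurable borel"
    and lim: "AE x in lborel. (\<lambda>n. f n x) \<longlonglongrightarrow> g x"
    and le: "\<And>n. sq_norm (f n) \<le> B"
  shows "g \<in> h_half" "sq_norm g \<le> B"
proof -
  note [measurable] = h_half_measurable[OF f] g
  have "AE z in hyp. (\<lambda>n. (incr (f n) z)\<^sup>2) \<longlonglongrightarrow> (incr g z)\<^sup>2"
    using AE_hyp[OF lim] by eventually_elim (auto intro!: tendsto_intros)
  from integral_le_limit[OF _ _ _ _ this, of "\<lambda>_. B" B] f le
  show "g \<in> h_half" "sq_norm g \<le> B" by (auto simp: h_half_def sq_norm_def)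
qed

text \<open>Uniform convexity makes a minimising sequence Cauchy in \<open>sq_norm\<close>, and the
  Poincare inequality makes it Cauchy in \<open>L^1\<close>. A subsequence then converges almost
  everywhere, and Fatou bounds both norm and energy of the limit.\<close>

lemma exists_minimizer:
  assumes f0: "f0 \<in> admissible a c" "sq_norm f0 \<le> r" and r: "sobolev_const * r \<le> 1 / 2" "r > 0" and a: "a < 1"
  obtains f where "f \<in> admissible a c" "sq_norm f \<le> r"
    "\<And>g. g \<in> admissible a c \<Longrightarrow> sq_norm g \<le> r \<Longrightarrow> energy f \<le> energy g"
proof -
  define S where "S = {g \<in> admissible a c. sq_norm g \<le> r}"
  define I where "I = Inf (energy ` S)"
  have S: "S \<noteq> {}" using f0 by (auto simp: S_def)
  have bdd: "bdd_below (energy ` S)" by (intro bdd_belowI[of _ 0]) (auto simp: energy_nonneg)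
  have I_le: "I \<le> energy g" if "g \<in> S" for g unfolding I_def using that by (intro cInf_lower bdd) auto
  have "\<exists>g\<in>S. energy g < I + 1 / real (Suc n)" for n
    using cInf_lessD[of "energy ` S" "I + 1 / real (Suc n)"] S by (auto simp: I_def)
  then obtain g where g: "\<And>n. g n \<in> S" "\<And>n. energy (g n) < I + 1 / real (Suc n)" by metis
  have gh: "g n \<in> h_half" and gr: "sq_norm (g n) \<le> r" and out: "\<And>x. x \<notin> {-1<..<1} \<Longrightarrow> g n x = 0"
    and mid: "\<And>x. x \<in> {-a..a} \<Longrightarrow> g n x = c" for n
    using g(1)[of n] by (auto simp: S_def admissible_def)
  note [measurable] = h_half_measurable[OF gh]
  have diff: "(\<lambda>x. g i x - g j x) \<in> h_half" for i j
    using h_half_lincomb(1)[OF gh gh, of 1 i "-1" j] by simp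
  \<comment> \<open>By \<open>energy_midpoint\<close>, \<open>sq_norm d\<close> is at most four
    times the mean energy excess, hence at most twice the sum of the two tolerances; the full
    difference is \<open>2 d\<close>, giving the factor \<open>8\<close>.\<close>
  have close: "sq_norm (\<lambda>x. g i x - g j x) \<le> 8 * (1 / real (Suc i) + 1 / real (Suc j))" for i j
  proof -
    define d where "d = (\<lambda>x. 1/2 * g i x + -(1/2) * g j x)"
    define m where "m = (\<lambda>x. 1/2 * g i x + 1/2 * g j x)"
    have "(\<lambda>x. g i x - g j x) = (\<lambda>x. 2 * d x)" by (auto simp: d_def field_simps)
    then have eq: "sq_norm (\<lambda>x. g i x - g j x) = 4 * sq_norm d"
      by (simp only: sq_norm_scale) simp
    show ?thesis
    proof (cases "sq_norm d > 0")
      case True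
      have "sq_norm m \<le> r"
        using sq_norm_midpoint[OF gh[of i] gh[of j], folded m_def d_def] gr[of i] gr[of j] True by argo
      then have "m \<in> S" using admissible_average[of "g i" a c "g j"] g(1)[of i] g(1)[of j] by (simp add: S_def m_def)
      from I_le[OF this] energy_midpoint[OF gh[of i] gr[of i] gh[of j] gr[of j] r, folded m_def d_def, OF True]
      have "sq_norm d / 4 \<le> (energy (g i) + energy (g j)) / 2 - I" by linarith
      then show ?thesis unfolding eq using g(2)[of i] g(2)[of j] by argo
    next
      case False
      then have "sq_norm d = 0" using sq_norm_nonneg[of d] by linarith
      then show ?thesis unfolding eq by simp
    qed
  qed
  have cauchy: "\<exists>N. \<forall>i\<ge>N. \<forall>j\<ge>N. (LINT x|lborel. norm (g i x - g j x)) < e" if e: "e > 0" for e :: real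
  proof -
    \<comment> \<open>With parameter \<open>e / 2\<close> in \<open>poincare_L1\<close>, the
      threshold \<open>e^2 / 400\<close> leaves \<open>e / 2 + 0.36 e\<close>, which is below
      \<open>e\<close>.\<close>
    obtain N where N: "1 / real (Suc N) < e\<^sup>2 / 400" using e nat_approx_posE[of "e\<^sup>2 / 400"] by auto
    show ?thesis
    proof (intro exI[of _ N] allI impI)
      fix i j assume ij: "i \<ge> N" "j \<ge> N"
      have "1 / real (Suc i) \<le> 1 / real (Suc N)" "1 / real (Suc j) \<le> 1 / real (Suc N)"
        using ij by (auto intro!: divide_left_mono)
      then have *: "sq_norm (\<lambda>x. g i x - g j x) \<le> 16 * (e\<^sup>2 / 400)" using close[of i j] N by argo
      have "(LINT x|lborel. \<bar>g i x - g j x\<bar>) \<le> e / 2 + 9 * sq_norm (\<lambda>x. g i x - g j x) / (2 * (e / 2))"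
        using e by (intro poincare_L1 diff) (auto simp: out)
      also have "\<dots> \<le> e / 2 + 9 * (16 * (e\<^sup>2 / 400)) / (2 * (e / 2))"
        using e * by (intro add_left_mono divide_right_mono) auto
      also have "\<dots> < e" using e by (simp add: power2_eq_square)
      finally show "(LINT x|lborel. norm (g i x - g j x)) < e" by simp
    qed
  qed
  have "integrable lborel (g n)" for n using poincare_L1(1)[OF gh out, of 1] by auto
  from cauchy_L1_AE_cauchy_subseq[of lborel g, OF this cauchy]
  obtain \<rho> where \<rho>: "strict_mono \<rho>" "AE x in lborel. Cauchy (\<lambda>i. g (\<rho> i) x)" by blast
  \<comment> \<open>Prescribing the boundary values makes the constraints hold everywhere, not just
    almost everywhere. Since \<open>a < 1\<close>, the first two cases do not overlap.\<close>
  define h where "h x = (if x \<in> {-a..a} then c else if x \<notin> {-1<..<1} then 0 else lim (\<lambda>i. g (\<rho> i) x))" for x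
  have [measurable]: "h \<in> borel_measurable borel" unfolding h_def by measurable
  have lim: "AE x in lborel. (\<lambda>i. g (\<rho> i) x) \<longlonglongrightarrow> h x"
    using \<rho>(2) by eventually_elim
      (auto simp: h_def out mid Cauchy_convergent_iff convergent_LIMSEQ_iff)
  have h: "h \<in> h_half" "sq_norm h \<le> r"
    by (rule h_half_limit[OF gh _ lim gr], measurable)+
  have "energy h \<le> I + 0"
    unfolding energy_def
  proof (rule integral_le_limit(2))
    show "integrable hyp (\<lambda>z. 1 - cos (incr (g (\<rho> n)) z))" for n by (rule integrable_energy[OF gh])
    show "AE z in hyp. (\<lambda>i. 1 - cos (incr (g (\<rho> i)) z)) \<longlonglongrightarrow> 1 - cos (incr h z)"
      using AE_hyp[OF lim] by eventually_elim (auto intro!: tendsto_intros)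
    show "(\<lambda>n. I + 1 / real (Suc n)) \<longlonglongrightarrow> I + 0"
      by (intro tendsto_intros LIMSEQ_Suc[OF lim_1_over_n])
    show "(\<integral>z. 1 - cos (incr (g (\<rho> n)) z) \<partial>hyp) \<le> I + 1 / real (Suc n)" for n
    proof -
      have "n \<le> \<rho> n" using \<rho>(1) by (rule seq_suble)
      then have "1 / real (Suc (\<rho> n)) \<le> 1 / real (Suc n)" by (auto intro!: divide_left_mono)
      then show ?thesis using g(2)[of "\<rho> n"] by (simp add: energy_def)
    qed
  qed auto
  moreover have "h \<in> admissible a c"
    unfolding admissible_def mem_Collect_eq
    using h(1) a out[of _ 0] mid[of _ 0] by (auto simp: h_def)
  ultimately show ?thesis
    using h(2) I_le by (intro that[of h]) (auto simp: S_def intro: order_trans)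
qed

section \<open>First variation\<close>

lemma cos_taylor2: "1 - cos (s + t) \<le> (1 - cos s) + t * sin s + t\<^sup>2" for s t :: real
proof -
  obtain u where "sin t = (\<Sum>m<2. sin_coeff m * t ^ m) + sin (u + 1 / 2 * real 2 * pi) / fact 2 * t ^ 2"
    using Maclaurin_sin_expansion[of t 2] by blast
  then have "sin t - t = - sin u / 2 * t\<^sup>2" by (simp add: numeral_eq_Suc sin_coeff_def)
  then have "\<bar>sin t - t\<bar> \<le> t\<^sup>2 / 2"
    using mult_right_mono[OF abs_sin_le_one[of u], of "t\<^sup>2"] by (simp add: abs_mult)
  then have "\<bar>sin s * (sin t - t)\<bar> \<le> 1 * (t\<^sup>2 / 2)"
    unfolding abs_mult by (intro mult_mono) auto
  then have "sin s * (sin t - t) \<le> t\<^sup>2 / 2" by linarith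
  moreover have "cos s * (1 - cos t) \<le> 1 * (1 - cos t)" by (intro mult_right_mono) auto
  moreover have "1 - cos (s + t) = 1 - cos s + t * sin s + cos s * (1 - cos t) + sin s * (sin t - t)"
    by (simp add: cos_add algebra_simps)
  moreover have "1 - cos t \<le> t\<^sup>2 / 2" by (rule one_minus_cos_le)
  ultimately show ?thesis by argo
qed

text \<open>The upper bound \<open>energy f + t S + t^2 sq_norm p\<close> for the energy of
  \<open>f + t p\<close>, compared with minimality for both signs of small \<open>t\<close>, forces
  the first variation \<open>S\<close> to vanish. The strict bound on \<open>sq_norm f\<close> keeps
  \<open>f + t p\<close> in the ball.\<close>

lemma euler_lagrange:
  assumes f: "f \<in> admissible a c" "sq_norm f < r"
    and min: "\<And>g. g \<in> admissible a c \<Longrightarrow> sq_norm g \<le> r \<Longrightarrow> energy f \<le> energy g"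
    and p: "p \<in> admissible a 0"
  shows "integrable hyp (\<lambda>z. sin (incr f z) * incr p z)" "(\<integral>z. sin (incr f z) * incr p z \<partial>hyp) = 0"
proof -
  have fh: "f \<in> h_half" and ph: "p \<in> h_half" using f p by (auto simp: admissible_def)
  note [measurable] = h_half_measurable[OF fh] h_half_measurable[OF ph]
  note L = h_half_lincomb[OF fh ph]
  show I: "integrable hyp (\<lambda>z. sin (incr f z) * incr p z)"
    by (rule Bochner_Integration.integrable_bound[OF L(2)])
       (auto simp: abs_mult intro!: AE_I2 mult_right_mono abs_sin_x_le_abs_x)
  define S where "S = (\<integral>z. sin (incr f z) * incr p z \<partial>hyp)"
  define J where "J = (\<integral>z. incr f z * incr p z \<partial>hyp)"
  have Ip: "integrable hyp (\<lambda>z. (incr p z)\<^sup>2)" using ph by (simp add: h_half_def)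
  have up: "energy (\<lambda>x. 1 * f x + t * p x) \<le> energy f + t * S + t\<^sup>2 * sq_norm p" for t
  proof -
    have "energy (\<lambda>x. 1 * f x + t * p x) \<le> (\<integral>z. (1 - cos (incr f z)) + t * (sin (incr f z) * incr p z) + t\<^sup>2 * (incr p z)\<^sup>2 \<partial>hyp)"
      unfolding energy_def
    proof (rule integral_mono)
      show "1 - cos (incr (\<lambda>x. 1 * f x + t * p x) z) \<le> (1 - cos (incr f z)) + t * (sin (incr f z) * incr p z) + t\<^sup>2 * (incr p z)\<^sup>2" for z
      proof -
        have "incr (\<lambda>x. 1 * f x + t * p x) z = incr f z + t * incr p z" by (simp add: algebra_simps)
        then show ?thesis using cos_taylor2[of "incr f z" "t * incr p z"]
          by (simp only: power_mult_distrib mult.commute mult.left_commute)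
      qed
      show "integrable hyp (\<lambda>z. 1 - cos (incr (\<lambda>x. 1 * f x + t * p x) z))" by (rule integrable_energy[OF L(1)])
    qed (use integrable_energy[OF fh] I Ip in \<open>auto simp del: Bochner_Integration.integrable_diff\<close>)
    also have "\<dots> = energy f + t * S + t\<^sup>2 * sq_norm p"
      using integrable_energy[OF fh] I Ip by (simp add: energy_def S_def sq_norm_def del: Bochner_Integration.integral_diff)
    finally show ?thesis .
  qed
  have "((\<lambda>t. sq_norm f + 2 * t * J + t\<^sup>2 * sq_norm p) \<longlongrightarrow> sq_norm f + 2 * 0 * J + 0\<^sup>2 * sq_norm p) (at 0)"
    by (intro tendsto_intros)
  then have "eventually (\<lambda>t. sq_norm f + 2 * t * J + t\<^sup>2 * sq_norm p < r) (at 0)"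
    using f(2) by (intro order_tendstoD(2)) auto
  then obtain \<delta> where \<delta>: "\<delta> > 0" "\<And>t. t \<noteq> 0 \<Longrightarrow> \<bar>t\<bar> < \<delta> \<Longrightarrow> sq_norm f + 2 * t * J + t\<^sup>2 * sq_norm p < r"
    unfolding eventually_at by (auto simp: dist_real_def)
  have low: "0 \<le> t * S + t\<^sup>2 * sq_norm p" if t: "t \<noteq> 0" "\<bar>t\<bar> < \<delta>" for t
  proof -
    have "(\<lambda>x. 1 * f x + t * p x) \<in> admissible a c"
      using f(1) p L(1)[of 1 t] by (auto simp: admissible_def)
    moreover have "sq_norm (\<lambda>x. 1 * f x + t * p x) \<le> r"
      using \<delta>(2)[OF t] L(3)[of 1 t] by (simp add: J_def)
    ultimately show ?thesis using min up[of t] by fastforce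
  qed
  have "\<bar>S\<bar> \<le> \<eta> * sq_norm p" if "0 < \<eta>" "\<eta> < \<delta>" for \<eta>
  proof -
    have "0 \<le> \<eta> * (S + \<eta> * sq_norm p)" "0 \<le> \<eta> * (- S + \<eta> * sq_norm p)"
      using low[of \<eta>] low[of "- \<eta>"] that by (auto simp: power2_eq_square algebra_simps)
    then show ?thesis using that by (auto simp: zero_le_mult_iff)
  qed
  note bound = this
  show "S = 0"
  proof (rule ccontr)
    assume "S \<noteq> 0"
    \<comment> \<open>Small enough that \<open>bound\<close> would give
      \<open>|S| \<le> |S| / 2\<close>; the summand \<open>1\<close> guards against
      \<open>sq_norm p = 0\<close>.\<close>
    define \<eta> where "\<eta> = min (\<delta> / 2) (\<bar>S\<bar> / (2 * (sq_norm p + 1)))"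
    have pos: "sq_norm p + 1 > 0" using sq_norm_nonneg[of p] by linarith
    then have "0 < \<eta>" "\<eta> < \<delta>" using \<delta>(1) \<open>S \<noteq> 0\<close> by (auto simp: \<eta>_def min_less_iff_disj)
    from bound[OF this] have "\<bar>S\<bar> \<le> \<eta> * (sq_norm p + 1)" using \<open>0 < \<eta>\<close> by (simp add: algebra_simps)
    also have "\<dots> \<le> \<bar>S\<bar> / (2 * (sq_norm p + 1)) * (sq_norm p + 1)"
      using pos by (intro mult_right_mono) (auto simp: \<eta>_def)
    also have "\<dots> = \<bar>S\<bar> / 2" using pos by (simp add: divide_simps)
    finally show False using \<open>S \<noteq> 0\<close> by simp
  qed
qed

subsection \<open>Cutoffs and test functions\<close>

lemma nn_integral_inverse_one_plus_square: "(\<integral>\<^sup>+x. ennreal (1 / (1 + x\<^sup>2)) \<partial>lborel) < \<infinity>"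
proof -
  have pos: "1 + x\<^sup>2 > 0" for x :: real by (simp add: add_pos_nonneg)
  have A: "(\<integral>\<^sup>+x. ennreal (1 / (1 + x\<^sup>2)) * indicator {0..} x \<partial>lborel) = ennreal (pi / 2 - arctan 0)"
    using pos by (intro nn_integral_FTC_atLeast)
      (auto intro!: derivative_eq_intros tendsto_arctan_at_top simp: field_simps less_imp_le)
  have "(\<integral>\<^sup>+x. ennreal (1 / (1 + x\<^sup>2)) \<partial>lborel)
    \<le> (\<integral>\<^sup>+x. ennreal (1 / (1 + x\<^sup>2)) * indicator {0..} x + ennreal (1 / (1 + (-x)\<^sup>2)) * indicator {0..} (-x) \<partial>lborel)"
    by (intro nn_integral_mono) (auto split: split_indicator)
  also have "\<dots> = (\<integral>\<^sup>+x. ennreal (1 / (1 + x\<^sup>2)) * indicator {0..} x \<partial>lborel)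
      + (\<integral>\<^sup>+x. ennreal (1 / (1 + (-x)\<^sup>2)) * indicator {0..} (-x) \<partial>lborel)"
    by (intro nn_integral_add) auto
  also have "(\<integral>\<^sup>+x. ennreal (1 / (1 + (-x)\<^sup>2)) * indicator {0..} (-x) \<partial>lborel)
      = (\<integral>\<^sup>+x. ennreal (1 / (1 + x\<^sup>2)) * indicator {0..} x \<partial>lborel)"
    by (subst (2) nn_integral_real_affine[where c="-1" and t=0]) auto
  also have "(\<integral>\<^sup>+x. ennreal (1 / (1 + x\<^sup>2)) * indicator {0..} x \<partial>lborel) +
      (\<integral>\<^sup>+x. ennreal (1 / (1 + x\<^sup>2)) * indicator {0..} x \<partial>lborel) < \<infinity>"
    unfolding A by simp
  finally show ?thesis .
qed

text \<open>The squared difference quotient is dominated by a product of two integrable functions: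
  the Lipschitz bound handles nearby points, boundedness of \<open>f\<close> handles distant
  ones.\<close>

lemma lipschitz_h_half:
  assumes lip: "\<And>x y. \<bar>f x - f y\<bar> \<le> L * \<bar>x - y\<bar>" and out: "\<And>x. x \<notin> {-1<..<1} \<Longrightarrow> f x = 0"
  shows "f \<in> h_half"
proof -
  have L: "L \<ge> 0" using order_trans[OF abs_ge_zero lip[of 0 1]] by simp
  have "continuous_on UNIV f"
    by (rule lipschitz_on_continuous_on[of L]) (auto intro!: lipschitz_onI L simp: dist_real_def lip)
  then have [measurable]: "f \<in> borel_measurable borel" by (rule borel_measurable_continuous_onI)
  have half: "(f x - f y)\<^sup>2 / (x - y)\<^sup>2 \<le> 70 * L\<^sup>2 * (1 / (1 + x\<^sup>2) * (1 / (1 + y\<^sup>2)))" if x: "x \<in> {-1<..<1}" for x y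
  proof (cases "x = y")
    case False
    define q where "q = (x - y)\<^sup>2"
    have q: "q > 0" using False by (simp add: q_def)
    have x1: "x\<^sup>2 \<le> 1" using x by (auto simp: abs_square_le_1)
    have "0 \<le> (2 * x - y)\<^sup>2" by simp
    then have y1: "1 + y\<^sup>2 \<le> 3 + 2 * q" using x1 by (simp add: q_def power2_eq_square algebra_simps)
    have fb: "\<bar>f z\<bar> \<le> 2 * L" for z
    proof (cases "z \<in> {-1<..<1}")
      case True
      have "\<bar>f z - f 1\<bar> \<le> L * \<bar>z - 1\<bar>" by (rule lip)
      also have "\<dots> \<le> L * 2" using True L by (intro mult_left_mono) auto
      finally show ?thesis by (simp add: out)
    qed (use L out in auto)
    have "\<bar>f x - f y\<bar> \<le> 4 * L" using fb[of x] fb[of y] by linarith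
    then have b1: "(f x - f y)\<^sup>2 \<le> 16 * L\<^sup>2"
      using power_mono[of "\<bar>f x - f y\<bar>" "4 * L" 2] by (simp add: power_mult_distrib)
    have b2: "(f x - f y)\<^sup>2 \<le> L\<^sup>2 * q"
      using power_mono[OF lip[of x y], of 2] by (simp add: power_mult_distrib q_def)
    have "(f x - f y)\<^sup>2 * (1 + y\<^sup>2) \<le> 35 * L\<^sup>2 * q"
    \<comment> \<open>At \<open>q = 16\<close> both regimes give the same constant:
      \<open>3 + 2 q = 35\<close>, and \<open>16 * (3 + 2 q) = 35 q\<close>.\<close>
    proof (cases "q \<le> 16")
      case True
      have "(f x - f y)\<^sup>2 * (1 + y\<^sup>2) \<le> (L\<^sup>2 * q) * 35"
        using y1 True q by (intro mult_mono b2) auto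
      then show ?thesis by simp
    next
      case False
      have "(f x - f y)\<^sup>2 * (1 + y\<^sup>2) \<le> (16 * L\<^sup>2) * (3 + 2 * q)"
        using y1 by (intro mult_mono b1) auto
      also have "\<dots> = L\<^sup>2 * (48 + 32 * q)" by (simp add: algebra_simps)
      also have "\<dots> \<le> L\<^sup>2 * (35 * q)" using False by (intro mult_left_mono) auto
      finally show ?thesis by simp
    qed
    then have "((f x - f y)\<^sup>2 * (1 + y\<^sup>2)) * (1 + x\<^sup>2) \<le> (35 * L\<^sup>2 * q) * 2"
      by (rule mult_mono) (use x1 q in auto)
    moreover have "1 + x\<^sup>2 > 0" "1 + y\<^sup>2 > 0" by (simp_all add: add_pos_nonneg)
    moreover have "u / q \<le> 70 * L\<^sup>2 * (1 / X * (1 / Y))" if "u * Y * X \<le> 35 * L\<^sup>2 * q * 2" "X > 0" "Y > 0" for u X Y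
      using that q by (simp add: field_simps)
    ultimately show ?thesis unfolding q_def by blast
  qed simp
  have bound: "(f x - f y)\<^sup>2 / (x - y)\<^sup>2 \<le> 70 * L\<^sup>2 * (1 / (1 + x\<^sup>2) * (1 / (1 + y\<^sup>2)))" for x y
  proof (cases "x \<in> {-1<..<1}")
    case False
    show ?thesis
    proof (cases "y \<in> {-1<..<1}")
      case True
      from half[OF this, of x] show ?thesis by (simp add: power2_commute mult.commute)
    qed (use False out in auto)
  qed (rule half)
  define K where "K = (\<integral>\<^sup>+x. ennreal (1 / (1 + x\<^sup>2)) \<partial>lborel)"
  have "gagliardo 2 f \<le> (\<integral>\<^sup>+x. \<integral>\<^sup>+y. ennreal (70 * L\<^sup>2) * (ennreal (1 / (1 + x\<^sup>2)) * ennreal (1 / (1 + y\<^sup>2))) \<partial>lborel \<partial>lborel)"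
    unfolding gagliardo_def
    by (intro nn_integral_mono) (use bound in \<open>simp add: ennreal_mult'[symmetric] ennreal_leI\<close>)
  also have "\<dots> = ennreal (70 * L\<^sup>2) * (K * K)"
    unfolding K_def by (simp add: nn_integral_cmult nn_integral_multc)
  finally have le: "gagliardo 2 f \<le> ennreal (70 * L\<^sup>2) * (K * K)" .
  have "K < \<infinity>" unfolding K_def by (rule nn_integral_inverse_one_plus_square)
  then have "ennreal (70 * L\<^sup>2) * (K * K) < \<infinity>" by (simp add: ennreal_mult_less_top)
  then obtain B where "ennreal (70 * L\<^sup>2) * (K * K) = ennreal B" "B \<ge> 0"
    by (cases "ennreal (70 * L\<^sup>2) * (K * K)") auto
  then show ?thesis using le by (intro h_halfI(1)[of f B]) auto
qed

text \<open>The measure \<open>dx dy / (x - y)^2\<close> is invariant under a common dilation of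
  both variables, so concentrating a cutoff at a point costs nothing.\<close>

lemma gagliardo_scale:
  assumes [measurable]: "f \<in> borel_measurable borel" and c: "c > 0"
  shows "gagliardo 2 (\<lambda>x. f (c * x)) = gagliardo 2 f"
proof -
  have "gagliardo 2 f = ennreal c * (\<integral>\<^sup>+x. \<integral>\<^sup>+y. ennreal (\<bar>f (c * x) - f y\<bar>\<^sup>2 / (c * x - y)\<^sup>2) \<partial>lborel \<partial>lborel)"
    unfolding gagliardo_def using c by (subst nn_integral_real_affine[where c=c and t=0]) auto
  also have "\<dots> = ennreal c * (\<integral>\<^sup>+x. ennreal c * (\<integral>\<^sup>+y. ennreal (\<bar>f (c * x) - f (c * y)\<bar>\<^sup>2 / (c * x - c * y)\<^sup>2) \<partial>lborel) \<partial>lborel)"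
    using c by (subst (2) nn_integral_real_affine[where c=c and t=0]) auto
  also have "\<dots> = (\<integral>\<^sup>+x. \<integral>\<^sup>+y. ennreal c * (ennreal c * ennreal (\<bar>f (c * x) - f (c * y)\<bar>\<^sup>2 / (c * x - c * y)\<^sup>2)) \<partial>lborel \<partial>lborel)"
    by (simp add: nn_integral_cmult)
  also have "\<dots> = gagliardo 2 (\<lambda>x. f (c * x))"
    unfolding gagliardo_def
  proof (intro nn_integral_cong)
    fix x y :: real
    have "c * (c * (\<bar>f (c * x) - f (c * y)\<bar>\<^sup>2 / (c * x - c * y)\<^sup>2)) = \<bar>f (c * x) - f (c * y)\<bar>\<^sup>2 / (x - y)\<^sup>2"
      using c by (simp add: right_diff_distrib[symmetric] power_mult_distrib) (simp add: power2_eq_square)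
    then show "ennreal c * (ennreal c * ennreal (\<bar>f (c * x) - f (c * y)\<bar>\<^sup>2 / (c * x - c * y)\<^sup>2))
       = ennreal (\<bar>f (c * x) - f (c * y)\<bar>\<^sup>2 / (x - y)\<^sup>2)"
      using c by (simp only: ennreal_mult'[symmetric] less_imp_le)
  qed
  finally show ?thesis ..
qed

lemma h_half_scale:
  assumes f: "f \<in> h_half" and c: "c > 0"
  shows "(\<lambda>x. f (c * x)) \<in> h_half" "sq_norm (\<lambda>x. f (c * x)) = sq_norm f"
proof -
  note [measurable] = h_half_measurable[OF f]
  have eq: "gagliardo 2 (\<lambda>x. f (c * x)) = ennreal (sq_norm f)"
    using gagliardo_scale[OF _ c, of f] h_half_gagliardo[OF f] by simp
  then show *: "(\<lambda>x. f (c * x)) \<in> h_half"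
    using sq_norm_nonneg[of f] by (intro h_halfI(1)[of _ "sq_norm f"]) auto
  show "sq_norm (\<lambda>x. f (c * x)) = sq_norm f"
    using eq h_half_gagliardo[OF *] by (simp add: sq_norm_nonneg)
qed

text \<open>A point has zero capacity.  If \<open>f\<close> nearly minimises the norm among cutoffs, so do its
  rescalings \<open>f (c x)\<close>; by the parallelogram law they are close to \<open>f\<close>, yet they tend to \<open>0\<close>.\<close>

lemma small_cutoff:
  assumes \<eta>: "\<eta> > 0"
  obtains \<zeta> \<delta> where "\<zeta> \<in> admissible \<delta> 1" "\<delta> > 0" "sq_norm \<zeta> < \<eta>"
proof -
  define S where "S = (\<Union>\<delta>\<in>{0<..}. admissible \<delta> 1)"
  define I where "I = Inf (sq_norm ` S)"
  have bdd: "bdd_below (sq_norm ` S)" by (intro bdd_belowI[of _ 0]) (auto simp: sq_norm_nonneg)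
  have I_le: "I \<le> sq_norm g" if "g \<in> S" for g unfolding I_def using that by (intro cInf_lower bdd) auto
  define tent :: "real \<Rightarrow> real" where "tent x = max 0 (min 1 (2 - 2 * \<bar>x\<bar>))" for x
  have "tent \<in> h_half"
    by (rule lipschitz_h_half[of _ 2]) (auto simp: tent_def max_def min_def abs_if)
  then have "tent \<in> admissible (1/2) 1"
    by (auto simp: admissible_def tent_def max_def min_def abs_if)
  then have S: "S \<noteq> {}" unfolding S_def by force
  obtain f where f: "f \<in> S" "sq_norm f < I + \<eta> / 8"
    using cInf_lessD[of "sq_norm ` S" "I + \<eta> / 8"] S \<eta> by (auto simp: I_def)
  then obtain \<delta> where \<delta>: "\<delta> > 0" "f \<in> admissible \<delta> 1" by (auto simp: S_def)
  have fh: "f \<in> h_half" and out: "\<And>x. x \<notin> {-1<..<1} \<Longrightarrow> f x = 0" and inn: "\<And>x. x \<in> {-\<delta>..\<delta>} \<Longrightarrow> f x = 1"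
    using \<delta> by (auto simp: admissible_def)
  define g where "g n x = f (real (Suc n) * x)" for n x
  have gh: "g n \<in> h_half" "sq_norm (g n) = sq_norm f" for n
    using h_half_scale[OF fh, of "real (Suc n)"] by (simp_all add: g_def[abs_def])
  have gS: "g n \<in> admissible (\<delta> / real (Suc n)) 1" for n
  proof -
    have "g n x = 0" if "x \<notin> {-1<..<1}" for x
    proof -
      have "1 * 1 \<le> real (Suc n) * \<bar>x\<bar>" using that by (intro mult_mono) auto
      then have "1 \<le> \<bar>real (Suc n) * x\<bar>" unfolding abs_mult by simp
      then show ?thesis unfolding g_def by (intro out) auto
    qed
    moreover have "g n x = 1" if "x \<in> {- (\<delta> / real (Suc n))..\<delta> / real (Suc n)}" for x
      unfolding g_def using that by (intro inn) (auto simp: field_simps)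
    ultimately show ?thesis using gh(1)[of n] by (simp add: admissible_def)
  qed
  \<comment> \<open>The midpoint has norm at least \<open>I\<close>, while the mean of the two norms
    is \<open>sq_norm f\<close>, below \<open>I + \<eta> / 8\<close>; the parallelogram law leaves
    at most \<open>\<eta> / 8\<close> for the half-difference.\<close>
  have close: "sq_norm (\<lambda>x. 1/2 * f x + -(1/2) * g n x) \<le> \<eta> / 8" for n
  proof -
    have "f \<in> admissible (\<delta> / real (Suc n)) 1"
    proof -
      have "\<delta> / real (Suc n) \<le> \<delta> / 1" using \<delta>(1) by (intro divide_left_mono) auto
      then show ?thesis using fh out by (auto simp: admissible_def intro!: inn)
    qed
    from admissible_average[OF this gS]
    have "(\<lambda>x. 1/2 * f x + 1/2 * g n x) \<in> S" using \<delta>(1) unfolding S_def by force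
    from I_le[OF this] sq_norm_midpoint[OF fh gh(1)[of n]] gh(2)[of n] f(2) show ?thesis by argo
  qed
  \<comment> \<open>Away from \<open>0\<close> the rescalings eventually vanish, so the
    half-differences converge to \<open>f / 2\<close> and the bound passes to it.\<close>
  have "sq_norm (\<lambda>x. 1/2 * f x) \<le> \<eta> / 8"
  proof (rule h_half_limit(2)[OF _ _ _ close])
    show "(\<lambda>x. 1/2 * f x + -(1/2) * g n x) \<in> h_half" for n by (intro h_half_lincomb fh gh)
    show "(\<lambda>x. 1/2 * f x) \<in> borel_measurable borel" using h_half_measurable[OF fh] by measurable
    have "AE x in lborel. x \<noteq> (0::real)" by (rule AE_lborel_singleton)
    then show "AE x in lborel. (\<lambda>n. 1/2 * f x + -(1/2) * g n x) \<longlonglongrightarrow> 1/2 * f x"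
    proof eventually_elim
      case (elim x)
      obtain n0 :: nat where "1 / \<bar>x\<bar> \<le> real n0" using real_arch_simple by blast
      then have n0: "1 \<le> real n0 * \<bar>x\<bar>" using elim by (simp add: field_simps)
      show ?case
      proof (rule tendsto_eventually, unfold eventually_sequentially, intro exI[of _ n0] allI impI)
        fix n assume n: "n0 \<le> n"
        have "real n0 * \<bar>x\<bar> \<le> real (Suc n) * \<bar>x\<bar>" using n by (intro mult_right_mono) auto
        then have "1 \<le> \<bar>real (Suc n) * x\<bar>" using n0 unfolding abs_mult by simp
        then have "g n x = 0" unfolding g_def by (intro out) auto
        then show "1/2 * f x + -(1/2) * g n x = 1/2 * f x" by simp
      qed
    qed
  qed
  then have "sq_norm f \<le> \<eta> / 2" unfolding sq_norm_scale by (simp add: power2_eq_square)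
  then show ?thesis using that[OF \<delta>(2,1)] \<eta> by simp
qed

lemma Cc_infty_admissible:
  assumes p: "p \<in> Cc_infty ({-1<..<-a} \<union> {a<..<1})" and a: "a > 0"
  shows "p \<in> admissible a 0"
proof -
  have diff: "(deriv ^^ n) p field_differentiable (at x)" for n x using p by (auto simp: Cc_infty_def)
  have zero: "p x = 0" if "x \<notin> {-1<..<-a} \<union> {a<..<1}" for x
    using p that closure_subset[of "{x. p x \<noteq> 0}"] by (auto simp: Cc_infty_def)
  have out: "p x = 0" if "x \<notin> {-1<..<1}" for x using that a by (intro zero) auto
  have D: "(p has_field_derivative deriv p x) (at x)" for x
    using diff[of 0 x] by (simp add: DERIV_deriv_iff_field_differentiable)
  have "continuous_on {-1..1} (deriv p)"
    using diff[of 1] by (auto intro!: continuous_at_imp_continuous_on field_differentiable_imp_continuous_at)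
  then have "bounded (deriv p ` {-1..1})" by (intro compact_imp_bounded compact_continuous_image) auto
  then obtain L where L: "\<And>x. x \<in> {-1..1} \<Longrightarrow> norm (deriv p x) \<le> L" unfolding bounded_iff by blast
  have lip: "norm (p x - p y) \<le> L * norm (x - y)" if "x \<in> {-1..1}" "y \<in> {-1..1}" for x y
    by (rule field_differentiable_bound[of "{-1..1}" p "deriv p"])
       (use that L in \<open>auto intro: has_field_derivative_at_within D\<close>)
  \<comment> \<open>Clamping to \<open>[-1, 1]\<close>, where the derivative is bounded, makes the
    Lipschitz estimate global; \<open>p\<close> does not change because it vanishes outside
    \<open>(-1, 1)\<close>.\<close>
  define cl where "cl x = max (-1) (min 1 x)" for x :: real
  have cl: "p (cl x) = p x" "cl x \<in> {-1..1}" for x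
    using out[of x] out[of 1] out[of "-1"] by (auto simp: cl_def max_def min_def)
  have "L \<ge> 0" using L[of 0] norm_ge_zero[of "deriv p 0"] by (auto simp del: norm_ge_zero)
  have "\<bar>p x - p y\<bar> \<le> L * \<bar>x - y\<bar>" for x y
  proof -
    have "\<bar>p x - p y\<bar> \<le> L * \<bar>cl x - cl y\<bar>" using lip[OF cl(2) cl(2), of x y] by (simp add: cl(1))
    also have "\<dots> \<le> L * \<bar>x - y\<bar>"
      using \<open>L \<ge> 0\<close> by (intro mult_left_mono) (auto simp: cl_def max_def min_def)
    finally show ?thesis .
  qed
  then have "p \<in> h_half" by (rule lipschitz_h_half) (rule out)
  then show ?thesis using out zero a by (auto simp: admissible_def)
qed

subsection \<open>Half-harmonic maps from phases\<close>

lemma cis_dot_H_half_S1: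
  assumes f: "f \<in> h_half"
  shows "(\<lambda>x. cis (f x)) \<in> dot_H_half_S1"
proof -
  note [measurable] = h_half_measurable[OF f]
  have m: "(\<lambda>x. cis (f x)) \<in> borel_measurable borel"
    unfolding cis_conv_exp by measurable
  have le: "(cmod (cis s - cis t))\<^sup>2 \<le> \<bar>s - t\<bar>\<^sup>2" for s t
  proof -
    have "(cmod (cis s - cis t))\<^sup>2 = ((sin s)\<^sup>2 + (cos s)\<^sup>2) + ((sin t)\<^sup>2 + (cos t)\<^sup>2) - 2 * cos (s - t)"
      by (simp only: cmod_power2 cos_diff) (simp add: power2_eq_square algebra_simps)
    then show ?thesis using one_minus_cos_le[of "s - t"] by simp
  qed
  have "(\<integral>\<^sup>+ x. \<integral>\<^sup>+ y. ennreal ((cmod (cis (f x) - cis (f y)))\<^sup>2 / \<bar>x - y\<bar>\<^sup>2) \<partial>lebesgue \<partial>lebesgue) \<le> gagliardo 2 f"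
    unfolding gagliardo_def nn_integral_completion power2_abs[of "_ - _ :: real"]
    using le by (intro nn_integral_mono ennreal_leI divide_right_mono) auto
  also have "\<dots> < \<infinity>" by (simp add: h_half_gagliardo[OF f])
  finally show ?thesis
    using m by (auto simp: dot_H_half_S1_def dot_H_half_def measurable_completion)
qed

text \<open>The tangent field \<open>i u p\<close> is the variation of \<open>cis f\<close> when the
  phase moves in direction \<open>p\<close>, so the weak equation for the map is the Euler-Lagrange
  equation of the phase. Integrability on the plane justifies the iterated integral by
  Fubini.\<close>

lemma cis_half_harmonic:
  assumes f: "f \<in> h_half"
    and EL: "\<And>p. p \<in> Cc_infty A \<Longrightarrow> p \<in> borel_measurable borel"
      "\<And>p. p \<in> Cc_infty A \<Longrightarrow> integrable hyp (\<lambda>z. sin (incr f z) * incr p z)"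
      "\<And>p. p \<in> Cc_infty A \<Longrightarrow> (\<integral>z. sin (incr f z) * incr p z \<partial>hyp) = 0"
  shows "half_harmonic_in A (\<lambda>x. cis (f x))"
  unfolding half_harmonic_in_def
proof (intro conjI ballI cis_dot_H_half_S1 f)
  fix p assume p: "p \<in> Cc_infty A"
  note [measurable] = h_half_measurable[OF f] EL(1)[OF p]
  define G where "G z = sin (incr f z) * incr p z / (fst z - snd z)\<^sup>2" for z
  have [measurable]: "G \<in> borel_measurable (lborel \<Otimes>\<^sub>M lborel)"
    unfolding G_def by measurable
  have point: "((cis s - cis t) \<bullet> (\<i> * cis s * of_real v - \<i> * cis t * of_real w)) = sin (s - t) * (v - w)"
    for s t v w
    by (simp add: inner_complex_def sin_diff algebra_simps)
  have "(LINT x|lebesgue. (LINT y|lebesgue. ((cis (f x) - cis (f y)) \<bullet> (\<i> * cis (f x) * of_real (p x) - \<i> * cis (f y) * of_real (p y))) / \<bar>x - y\<bar>\<^sup>2))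
    = (LINT x|lebesgue. (LINT y|lebesgue. G (x, y)))"
    unfolding point by (simp add: G_def)
  also have "\<dots> = (LINT x|lebesgue. (LINT y|lborel. G (x, y)))"
    by (subst integral_completion) auto
  also have "\<dots> = (LINT x|lborel. (LINT y|lborel. G (x, y)))"
    by (subst integral_completion) auto
  also have "\<dots> = (\<integral>z. G z \<partial>(lborel \<Otimes>\<^sub>M lborel))"
  proof (rule lborel_pair.integral_fst')
    show "integrable (lborel \<Otimes>\<^sub>M lborel) G"
      using EL(2)[OF p] unfolding hyp_def
      by (subst (asm) integrable_density) (auto simp: G_def[abs_def] lborel_prod)
  qed
  also have "\<dots> = (\<integral>z. sin (incr f z) * incr p z \<partial>hyp)"
    unfolding hyp_def by (subst integral_density) (auto simp: G_def[abs_def] lborel_prod)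
  finally show "(LINT x|lebesgue. (LINT y|lebesgue. ((cis (f x) - cis (f y)) \<bullet> (\<i> * cis (f x) * of_real (p x) - \<i> * cis (f y) * of_real (p y))) / \<bar>x - y\<bar>\<^sup>2)) = 0"
    unfolding EL(3)[OF p] .
qed

text \<open>Increments of \<open>w\<close> are zero or at least \<open>2 \<pi>\<close>, so the quartic norm dominates the quadratic one;
  for small \<open>w\<close> this contradicts the embedding unless \<open>w\<close> is constant.\<close>

lemma integer_valued_rigid:
  assumes w: "w \<in> admissible a c" and a: "a > 0" and small: "sobolev_const * sq_norm w \<le> 2"
    and int: "AE x in lborel. \<exists>n::int. w x = 2 * pi * of_int n"
  shows "c = 0"
proof -
  have wh: "w \<in> h_half" and out: "\<And>x. x \<notin> {-1<..<1} \<Longrightarrow> w x = 0" and inn: "\<And>x. x \<in> {-a..a} \<Longrightarrow> w x = c"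
    using w by (auto simp: admissible_def)
  note [measurable] = h_half_measurable[OF wh]
  have "AE z in hyp. 36 * (incr w z)\<^sup>2 \<le> incr w z ^ 4"
    using AE_hyp[OF int]
  proof eventually_elim
    case (elim z)
    then obtain m n :: int where "w (fst z) = 2 * pi * of_int m" "w (snd z) = 2 * pi * of_int n" by blast
    then have mn: "incr w z = 2 * pi * of_int (m - n)" by (simp add: algebra_simps)
    show ?case
    proof (cases "m = n")
      case False
      have "1 \<le> \<bar>real_of_int (m - n)\<bar>" using of_int_1_le_iff[of "\<bar>m - n\<bar>"] False by simp
      then have "2 * pi * 1 \<le> 2 * pi * \<bar>real_of_int (m - n)\<bar>" by (intro mult_left_mono) auto
      also have "\<dots> = \<bar>incr w z\<bar>" unfolding mn abs_mult by simp
      \<comment> \<open>Rounding \<open>2 \<pi>\<close> down to \<open>6\<close> gives the factor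
        \<open>36\<close>, well above the \<open>2\<close> allowed by \<open>small\<close>.\<close>
      finally have "6 \<le> \<bar>incr w z\<bar>" using pi_gt3 by linarith
      then have "6\<^sup>2 \<le> \<bar>incr w z\<bar>\<^sup>2" by (intro power_mono) auto
      then have "36 * (incr w z)\<^sup>2 \<le> (incr w z)\<^sup>2 * (incr w z)\<^sup>2" by (intro mult_right_mono) auto
      then show ?thesis by (simp add: power2_eq_square power4_eq_xxxx mult.assoc)
    qed (simp add: mn)
  qed
  then have "(\<integral>z. 36 * (incr w z)\<^sup>2 \<partial>hyp) \<le> (\<integral>z. incr w z ^ 4 \<partial>hyp)"
    using wh by (intro integral_mono_AE h_half_power4) (auto simp: h_half_def)
  also have "\<dots> \<le> sobolev_const * sq_norm w * sq_norm w"
    using h_half_power4(2)[OF wh] by (simp add: power2_eq_square mult.assoc)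
  also have "\<dots> \<le> 2 * sq_norm w" using small by (intro mult_right_mono sq_norm_nonneg)
  finally have "36 * sq_norm w \<le> 2 * sq_norm w" by (simp add: sq_norm_def)
  then have N0: "sq_norm w = 0" using sq_norm_nonneg[of w] by linarith
  \<comment> \<open>Vanishing \<open>sq_norm\<close> alone allows constants; the zero values outside
    \<open>(-1, 1)\<close> exclude them through the Poincare inequality, and the plateau of length
    \<open>2 a\<close> then gives \<open>c = 0\<close>.\<close>
  note P = poincare[OF wh out]
  have "(\<integral>x. c\<^sup>2 * indicat_real {-a..a} x \<partial>lborel) \<le> (\<integral>x. (w x)\<^sup>2 \<partial>lborel)"
    using P a by (intro integral_mono integrable_mult_right integrable_real_indicator) (auto simp: inn split: split_indicator)
  moreover have "(\<integral>x. c\<^sup>2 * indicat_real {-a..a} x \<partial>lborel) = c\<^sup>2 * (2 * a)"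
    using a by simp
  moreover have "(\<integral>x. (w x)\<^sup>2 \<partial>lborel) \<le> 0" using P(2) N0 by simp
  ultimately have "c\<^sup>2 * (2 * a) \<le> 0" by linarith
  then show "c = 0" using a by (simp add: mult_le_0_iff)
qed

section \<open>Distinctness of the maps, and the final choice of constants\<close>

lemma cis_eq_cisD: "cis s = cis t \<Longrightarrow> \<exists>n::int. s - t = 2 * pi * of_int n"
proof -
  assume "cis s = cis t"
  then have "sin s = sin t \<and> cos s = cos t" by (simp add: complex_eq_iff)
  then show ?thesis unfolding sin_cos_eq_iff by auto
qed

text \<open>Phases of equal maps differ by a function with values in \<open>2 \<pi> \<int>\<close>
  and plateau \<open>c - c'\<close>. By the parallelogram law its \<open>sq_norm\<close> is at most
  \<open>4 r\<close>, small enough for rigidity.\<close>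

lemma admissible_cis_distinct:
  assumes f: "f \<in> admissible a c" "sq_norm f \<le> r" and g: "g \<in> admissible a c'" "sq_norm g \<le> r"
    and a: "a > 0" and r: "sobolev_const * r \<le> 1 / 2"
    and eq: "AE x in lebesgue. cis (f x) = cis (g x)"
  shows "c = c'"
proof -
  have fh: "f \<in> h_half" and gh: "g \<in> h_half" using f g by (auto simp: admissible_def)
  define w where "w = (\<lambda>x. 2 * (1/2 * f x + -(1/2) * g x))"
  have w: "w = (\<lambda>x. f x - g x)" by (auto simp: w_def field_simps)
  have "w \<in> h_half" unfolding w using h_half_lincomb(1)[OF fh gh, of 1 "-1"] by simp
  then have "w \<in> admissible a (c - c')" using f g unfolding w by (auto simp: admissible_def)
  have "sq_norm w = 4 * sq_norm (\<lambda>x. 1/2 * f x + -(1/2) * g x)"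
    unfolding w_def sq_norm_scale by simp
  then have "sq_norm w \<le> 4 * r"
    using sq_norm_midpoint[OF fh gh] f(2) g(2) sq_norm_nonneg[of "\<lambda>x. 1/2 * f x + 1/2 * g x"] by argo
  then have "sobolev_const * sq_norm w \<le> sobolev_const * (4 * r)"
    by (intro mult_left_mono) (auto simp: sobolev_const_def)
  then have "sobolev_const * sq_norm w \<le> 2" using r by argo
  moreover have "AE x in lborel. \<exists>n::int. w x = 2 * pi * of_int n"
    using eq unfolding AE_completion_iff by eventually_elim (auto simp: w dest: cis_eq_cisD)
  ultimately have "c - c' = 0" using \<open>w \<in> admissible _ _\<close> a by (intro integer_valued_rigid)
  then show ?thesis by simp
qed

theorem theorem1p1:
  fixes k :: nat
  assumes "k \<ge> 1"
  shows "\<exists>a0::real. 0 < a0 \<and> a0 < 1 \<and>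
    (\<forall>a::real. 0 < a \<and> a \<le> a0 \<longrightarrow>
      (\<exists>u :: nat \<Rightarrow> real \<Rightarrow> complex.
        (\<forall>i\<in>{1..k}.
            u i \<in> dot_H_half_S1 \<and>
            \<not> (\<exists>c. AE x in lebesgue. u i x = c) \<and>
            half_harmonic_in ({-1<..<-a} \<union> {a<..<1}) (u i) \<and>
            (AE x in lebesgue. x \<notin> {-1<..<-a} \<union> {a<..<1} \<longrightarrow> u i x = 1)) \<and>
        (\<forall>i\<in>{1..k}. \<forall>j\<in>{1..k}. i \<noteq> j \<longrightarrow> \<not> (AE x in lebesgue. u i x = u j x))))"
proof -
  \<comment> \<open>The largest radius allowed in the convexity estimate, which requires
    \<open>sobolev_const * r \<le> 1 / 2\<close>.\<close>
  define r where "r = 1 / (2 * sobolev_const)"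
  have r: "sobolev_const * r \<le> 1 / 2" "r > 0" by (auto simp: r_def sobolev_const_def)
  \<comment> \<open>The largest factor by which \<open>sq_norm \<zeta>\<close> grows when the cutoff
    is raised to a level \<open>2 \<pi> i\<close> with \<open>i \<le> k\<close>. A single cutoff,
    with a plateau containing every \<open>[-a, a]\<close>, thus serves all levels.\<close>
  define M where "M = (2 * pi * real k)\<^sup>2"
  have M: "M > 0" using assms by (simp add: M_def)
  obtain \<zeta> \<delta> where \<zeta>: "\<zeta> \<in> admissible \<delta> 1" and \<delta>: "\<delta> > 0" and small: "sq_norm \<zeta> < r / (2 * M)"
    using small_cutoff[of "r / (2 * M)"] r M by auto
  have \<zeta>h: "\<zeta> \<in> h_half" using \<zeta> by (simp add: admissible_def)
  have sol: "\<exists>f. f \<in> admissible a (2 * pi * real i) \<and> sq_norm f \<le> r \<and> half_harmonic_in ({-1<..<-a} \<union> {a<..<1}) (\<lambda>x. cis (f x))"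
    if i: "i \<in> {1..k}" and a: "0 < a" "a \<le> min \<delta> (1/2)" for i a
  proof -
    define f0 where "f0 = (\<lambda>x. (2 * pi * real i) * \<zeta> x)"
    have f0h: "f0 \<in> h_half" using h_half_lincomb(1)[OF \<zeta>h \<zeta>h, of "2 * pi * real i" 0] by (simp add: f0_def)
    then have f0: "f0 \<in> admissible a (2 * pi * real i)"
      using \<zeta> a by (auto simp: admissible_def f0_def)
    have "sq_norm f0 = (2 * pi * real i)\<^sup>2 * sq_norm \<zeta>" unfolding f0_def sq_norm_scale ..
    also have "\<dots> \<le> M * sq_norm \<zeta>"
      unfolding M_def using i by (intro mult_right_mono power_mono sq_norm_nonneg) auto
    also have "\<dots> < M * (r / (2 * M))" using small M by (intro mult_strict_left_mono)
    also have "\<dots> = r / 2" using M by simp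
    finally have f0r: "sq_norm f0 < r / 2" .
    obtain f where f: "f \<in> admissible a (2 * pi * real i)" "sq_norm f \<le> r"
      and min: "\<And>g. g \<in> admissible a (2 * pi * real i) \<Longrightarrow> sq_norm g \<le> r \<Longrightarrow> energy f \<le> energy g"
      using exists_minimizer[OF f0 _ r, of thesis] f0r r(2) a by auto
    have fh: "f \<in> h_half" using f by (simp add: admissible_def)
    \<comment> \<open>Now the minimiser is shown to be interior: \<open>sq_norm f / 4 \<le> energy f
      \<le> energy f0 \<le> sq_norm f0 / 2 < r / 4\<close>.\<close>
    have "sobolev_const * sq_norm f \<le> sobolev_const * r" using f(2) by (intro mult_left_mono) (auto simp: sobolev_const_def)
    then have "sq_norm f / 4 \<le> energy f" using r by (intro energy_ge fh) linarith
    also have "energy f \<le> energy f0" using f0r r by (intro min f0) linarith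
    also have "\<dots> \<le> sq_norm f0 / 2" by (rule energy_le[OF f0h])
    finally have fr: "sq_norm f < r" using f0r by linarith
    have "half_harmonic_in ({-1<..<-a} \<union> {a<..<1}) (\<lambda>x. cis (f x))"
    proof (rule cis_half_harmonic[OF fh])
      fix p assume "p \<in> Cc_infty ({-1<..<-a} \<union> {a<..<1})"
      then have p: "p \<in> admissible a 0" using a by (intro Cc_infty_admissible)
      show "p \<in> borel_measurable borel" using p by (simp add: admissible_def h_half_def)
      show "integrable hyp (\<lambda>z. sin (incr f z) * incr p z)" "(\<integral>z. sin (incr f z) * incr p z \<partial>hyp) = 0"
        by (rule euler_lagrange[OF f(1) fr min p]; assumption)+
    qed
    with f show ?thesis by blast
  qed
  show ?thesis
  proof (intro exI[of _ "min \<delta> (1/2)"] conjI allI impI)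
    fix a :: real assume a: "0 < a \<and> a \<le> min \<delta> (1/2)"
    have "\<forall>i\<in>{1..k}. \<exists>f. f \<in> admissible a (2 * pi * real i) \<and> sq_norm f \<le> r \<and>
        half_harmonic_in ({-1<..<-a} \<union> {a<..<1}) (\<lambda>x. cis (f x))"
      using sol a by blast
    from bchoice[OF this]
    obtain f where f: "\<And>i. i \<in> {1..k} \<Longrightarrow> f i \<in> admissible a (2 * pi * real i)"
        "\<And>i. i \<in> {1..k} \<Longrightarrow> sq_norm (f i) \<le> r"
        "\<And>i. i \<in> {1..k} \<Longrightarrow> half_harmonic_in ({-1<..<-a} \<union> {a<..<1}) (\<lambda>x. cis (f i x))"
      by blast
    show "\<exists>u :: nat \<Rightarrow> real \<Rightarrow> complex.
        (\<forall>i\<in>{1..k}.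
            u i \<in> dot_H_half_S1 \<and>
            \<not> (\<exists>c. AE x in lebesgue. u i x = c) \<and>
            half_harmonic_in ({-1<..<-a} \<union> {a<..<1}) (u i) \<and>
            (AE x in lebesgue. x \<notin> {-1<..<-a} \<union> {a<..<1} \<longrightarrow> u i x = 1)) \<and>
        (\<forall>i\<in>{1..k}. \<forall>j\<in>{1..k}. i \<noteq> j \<longrightarrow> \<not> (AE x in lebesgue. u i x = u j x))"
    proof (intro exI[of _ "\<lambda>i x. cis (f i x)"] conjI ballI impI)
      fix i assume i: "i \<in> {1..k}"
      show "(\<lambda>x. cis (f i x)) \<in> dot_H_half_S1"
        using f(1)[OF i] by (intro cis_dot_H_half_S1) (simp add: admissible_def)
      show "half_harmonic_in ({-1<..<-a} \<union> {a<..<1}) (\<lambda>x. cis (f i x))" by (rule f(3)[OF i])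
      have val: "f i x = 0 \<or> f i x = 2 * pi * real i" if "x \<notin> {-1<..<-a} \<union> {a<..<1}" for x
        using f(1)[OF i] that by (auto simp: admissible_def not_less)
      have "cis (2 * pi * real i) = 1" using cis_multiple_2pi[of "real i"] by simp
      then show "AE x in lebesgue. x \<notin> {-1<..<-a} \<union> {a<..<1} \<longrightarrow> cis (f i x) = 1"
        using val by (intro AE_I2) force
      show "\<not> (\<exists>c. AE x in lebesgue. cis (f i x) = c)"
      proof
        assume "\<exists>c. AE x in lebesgue. cis (f i x) = c"
        then obtain c where c: "AE x in lborel. cis (f i x) = c" unfolding AE_completion_iff by blast
        \<comment> \<open>The map equals \<open>1\<close> on \<open>[1, 2]\<close>, a set of
          positive measure.\<close>
        have "c = 1"
        proof (rule ccontr)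
          assume "c \<noteq> 1"
          have "AE x in lborel. x \<notin> {1..2::real}"
            using c
          proof eventually_elim
            case (elim x)
            have "f i x = 0" if "x \<in> {1..2}" using f(1)[OF i] that by (auto simp: admissible_def)
            then show ?case using elim \<open>c \<noteq> 1\<close> by auto
          qed
          then have "{1..2::real} \<in> null_sets lborel"
            using AE_iff_null_sets[of "{1..2::real}" lborel] by simp
          then show False by (simp add: null_sets_def)
        qed
        \<comment> \<open>The zero phase is the level \<open>n = 0\<close>, so non-constancy becomes
          a case of distinctness of levels.\<close>
        have zero: "(\<lambda>x. 0) \<in> admissible a 0" "sq_norm (\<lambda>x. 0) \<le> r"
          using r by (auto simp: admissible_def h_half_def sq_norm_def)
        have "AE x in lebesgue. cis (f i x) = cis 0"
          using c \<open>c = 1\<close> unfolding AE_completion_iff by simp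
        from admissible_cis_distinct[OF f(1)[OF i] f(2)[OF i] zero _ r(1) this] a
        show False using i by simp
      qed
    next
      fix i j assume ij: "i \<in> {1..k}" "j \<in> {1..k}" "i \<noteq> j"
      show "\<not> (AE x in lebesgue. cis (f i x) = cis (f j x))"
      proof
        assume "AE x in lebesgue. cis (f i x) = cis (f j x)"
        from admissible_cis_distinct[OF f(1)[OF ij(1)] f(2)[OF ij(1)] f(1)[OF ij(2)] f(2)[OF ij(2)] _ r(1) this] a
        show False using ij by simp
      qed
    qed
  qed (use \<delta> in auto)
qed

end
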